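(* Consider the following setting. There is a deterministic algorithm $\mathcal{A}$ which, when executed by every agent in the model described in the context, with every agent knowing a common integer $N \geq 2$ that is an upper bound on the number $n$ of nodes of the graph, solves both the gathering problem and the leader election problem, and whose time complexity is bounded by a polynomial in $N$ and in $\ell$, where $\ell$ is the length of the binary representation of the smallest label among the agents.
   Context: Model: the network is an undirected connected graph with $n$ nodes whose nodes are anonymous (unlabeled); at each node $v$ of degree $d$, the incident edges carry distinct port numbers $0,\dots,d-1$ (port numbering is local, with no relation between the two port numbers of an edge). A team of at least two mobile agents starts at pairwise distinct nodes. Agents have distinct labels which are positive integers; each agent knows its own label but not the labels of others, and all agents execute the same deterministic algorithm, parameterized by the agent's label. Time proceeds in synchronous rounds. An adversary wakes up some agents in possibly different rounds; a dormant agent is woken up when another agent first visits its starting node. Starting from its wake-up round, in each round an agent performs local computation and then either stays at its current node or moves to a neighbor through a chosen port. Upon entering a node, an agent learns its degree and the port of entry. Agents cannot mark nodes or edges, and agents crossing each other on an edge do not notice it. Agents have unlimited memory. Crucially, agents cannot communicate: co-located agents cannot see each other's labels nor exchange any information; the only information an agent gets about other agents is, in every round, the number of agents (including itself) present at the node it currently occupies. Agents see nothing outside their current node. The time complexity of an algorithm is the worst-case number of rounds from the wake-up of the earliest agent until the completion of the algorithm. Gathering problem: all agents must be at the same node and declare that they have all met (gathering is achieved). Leader election problem: one agent is elected as leader and all agents learn its label. *)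

theory Defs
  imports
    Complex_Main
    "HOL-Library.Nat_Bijection"
    "HOL-Library.Log_Nat"
    "HOL-Computational_Algebra.Polynomial"
begin

text \<open>
  Nodes are natural numbers, which loses no finite graph; agents never see them.
  The number \<^term>\<open>port G v w\<close> is the port at \<^term>\<open>v\<close> of the edge joining \<^term>\<open>v\<close> to \<^term>\<open>w\<close>;
  it is meaningful only for adjacent nodes.
\<close>

record network =
  nodes :: "nat set"
  edges :: "nat set set"
  port :: "nat \<Rightarrow> nat \<Rightarrow> nat"

definition neighbours :: "network \<Rightarrow> nat \<Rightarrow> nat set" where
  "neighbours G v = {w. {v, w} \<in> edges G}"

definition degree_at :: "network \<Rightarrow> nat \<Rightarrow> nat" where
  "degree_at G v = card (neighbours G v)"

definition neighbour_via :: "network \<Rightarrow> nat \<Rightarrow> nat \<Rightarrow> nat" where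
  "neighbour_via G v p = (THE w. w \<in> neighbours G v \<and> port G v w = p)"

definition connected_network :: "network \<Rightarrow> bool" where
  "connected_network G \<longleftrightarrow>
     (\<forall>u \<in> nodes G. \<forall>v \<in> nodes G. (u, v) \<in> {(x, y). {x, y} \<in> edges G}\<^sup>*)"

definition valid_network :: "network \<Rightarrow> bool" where
  "valid_network G \<longleftrightarrow>
     finite (nodes G) \<and> nodes G \<noteq> {} \<and>
     edges G \<subseteq> {{u, v} | u v. u \<in> nodes G \<and> v \<in> nodes G \<and> u \<noteq> v} \<and>
     connected_network G \<and>
     (\<forall>v \<in> nodes G. bij_betw (port G v) (neighbours G v) {..<degree_at G v})"

text \<open>
  An observation consists of the degree of the current node, the port by which the agent has
  entered it in this round (\<^term>\<open>None\<close> if it has not just moved), and the number of agents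
  there, itself included.
\<close>

type_synonym observation = "nat \<times> nat option \<times> nat"

text \<open>
  \<open>Declare L\<close> is final: the agent declares that all agents have met, announces \<open>L\<close> as the label
  of the leader, and remains at its node forever.
\<close>

datatype action = Stay | Move nat | Declare nat

text \<open>
  The action depends on the size bound, the agent's own label, and everything the agent has
  observed since its wake-up, listed with the \<^emph>\<open>most recent\<close> observation first. Previous actions
  need not be recorded, being determined by previous observations.
\<close>

type_synonym algorithm = "nat \<Rightarrow> nat \<Rightarrow> observation list \<Rightarrow> action"

text \<open>
  Total recursive functions of a given arity. Functions are applied to argument lists, and only
  lists whose length is the arity matter. Minimisation is restricted to the case where a zero
  always exists, so by Kleene's normal form theorem these are the total computable functions.
\<close>

inductive total_recursive :: "nat \<Rightarrow> (nat list \<Rightarrow> nat) \<Rightarrow> bool" where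
  zero: "total_recursive n (\<lambda>_. 0)"
| succ: "total_recursive 1 (\<lambda>xs. Suc (xs ! 0))"
| proj: "i < n \<Longrightarrow> total_recursive n (\<lambda>xs. xs ! i)"
| comp: "\<lbrakk>total_recursive m f; length gs = m; \<forall>g \<in> set gs. total_recursive n g\<rbrakk>
    \<Longrightarrow> total_recursive n (\<lambda>xs. f (map (\<lambda>g. g xs) gs))"
| prim_rec: "\<lbrakk>total_recursive n f; total_recursive (Suc (Suc n)) g\<rbrakk>
    \<Longrightarrow> total_recursive (Suc n)
          (\<lambda>xs. rec_nat (f (tl xs)) (\<lambda>k r. g (k # r # tl xs)) (hd xs))"
| minimise: "\<lbrakk>total_recursive (Suc n) f; \<forall>xs. length xs = n \<longrightarrow> (\<exists>k. f (k # xs) = 0)\<rbrakk>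
    \<Longrightarrow> total_recursive n (\<lambda>xs. LEAST k. f (k # xs) = 0)"

fun encode_observation :: "observation \<Rightarrow> nat" where
  "encode_observation (d, e, k) =
     prod_encode (d, prod_encode (case e of None \<Rightarrow> 0 | Some p \<Rightarrow> Suc p, k))"

fun encode_action :: "action \<Rightarrow> nat" where
  "encode_action Stay = prod_encode (0, 0)"
| "encode_action (Move p) = prod_encode (1, p)"
| "encode_action (Declare L) = prod_encode (2, L)"

definition computable :: "algorithm \<Rightarrow> bool" where
  "computable A \<longleftrightarrow>
     (\<exists>f. total_recursive 3 f \<and>
       (\<forall>N l h. f [N, l, list_encode (map encode_observation h)] = encode_action (A N l h)))"

text \<open>
  Agents are identified with their labels, so that labels are distinct. The adversary wakes agent
  \<open>a\<close> in round \<open>r\<close> if \<open>wake X a = Some r\<close>, unless it is already awake, and never wakes it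
  directly if \<open>wake X a = None\<close>.
\<close>

record scenario =
  net :: network
  team :: "nat set"
  start :: "nat \<Rightarrow> nat"
  wake :: "nat \<Rightarrow> nat option"

definition valid_scenario :: "scenario \<Rightarrow> bool" where
  "valid_scenario X \<longleftrightarrow>
     valid_network (net X) \<and>
     finite (team X) \<and> 2 \<le> card (team X) \<and> (\<forall>a \<in> team X. 0 < a) \<and>
     inj_on (start X) (team X) \<and> start X ` team X \<subseteq> nodes (net X) \<and>
     (\<exists>a \<in> team X. wake X a \<noteq> None)"

definition first_wake :: "scenario \<Rightarrow> nat" where
  "first_wake X = (LEAST r. \<exists>a \<in> team X. wake X a = Some r)"

datatype status = Dormant | Active "observation list" | Terminated

record agent_state =
  loc :: nat
  entry :: "nat option"
  status :: status

type_synonym configuration = "nat \<Rightarrow> agent_state"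

text \<open>
  The status of agent \<open>a\<close> in round \<open>r\<close> after wake-ups and observations, given the configuration
  \<open>c\<close> at the beginning of that round. Starting nodes being distinct, a dormant agent shares
  its node with another agent exactly when it is being visited.
\<close>

definition perceive :: "scenario \<Rightarrow> nat \<Rightarrow> configuration \<Rightarrow> nat \<Rightarrow> status" where
  "perceive X r c a =
     (let v = loc (c a);
          ob = (degree_at (net X) v, entry (c a), card {b \<in> team X. loc (c b) = v})
      in case status (c a) of
           Dormant \<Rightarrow>
             if wake X a = Some r \<or> (\<exists>b \<in> team X - {a}. loc (c b) = v)
             then Active [ob] else Dormant
         | Active h \<Rightarrow> Active (ob # h)
         | Terminated \<Rightarrow> Terminated)"

fun chosen_action :: "algorithm \<Rightarrow> nat \<Rightarrow> nat \<Rightarrow> status \<Rightarrow> action" where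
  "chosen_action A N a (Active h) = A N a h"
| "chosen_action A N a _ = Stay"

text \<open>An attempt to use a port that does not exist has no effect.\<close>

fun perform :: "network \<Rightarrow> nat \<Rightarrow> status \<Rightarrow> action \<Rightarrow> agent_state" where
  "perform G v s Stay = \<lparr>loc = v, entry = None, status = s\<rparr>"
| "perform G v s (Move p) =
     (if p < degree_at G v
      then let w = neighbour_via G v p in \<lparr>loc = w, entry = Some (port G w v), status = s\<rparr>
      else \<lparr>loc = v, entry = None, status = s\<rparr>)"
| "perform G v s (Declare L) = \<lparr>loc = v, entry = None, status = Terminated\<rparr>"

primrec run :: "algorithm \<Rightarrow> nat \<Rightarrow> scenario \<Rightarrow> nat \<Rightarrow> configuration" where
  "run A N X 0 = (\<lambda>a. \<lparr>loc = start X a, entry = None, status = Dormant\<rparr>)"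
| "run A N X (Suc r) =
     (\<lambda>a. let c = run A N X r; s = perceive X r c a
          in perform (net X) (loc (c a)) s (chosen_action A N a s))"

definition declares :: "algorithm \<Rightarrow> nat \<Rightarrow> scenario \<Rightarrow> nat \<Rightarrow> nat \<Rightarrow> nat \<Rightarrow> bool" where
  "declares A N X r a L \<longleftrightarrow>
     chosen_action A N a (perceive X r (run A N X r) a) = Declare L"

text \<open>
  In both definitions \<open>T\<close> bounds the number of rounds, counted from the wake-up of the earliest
  agent. Every declaration must be true when made, and the agents stay together from then on.
\<close>

definition gathers_within :: "algorithm \<Rightarrow> nat \<Rightarrow> scenario \<Rightarrow> nat \<Rightarrow> bool" where
  "gathers_within A N X T \<longleftrightarrow>
     (\<exists>v \<in> nodes (net X). \<forall>a \<in> team X. \<exists>r < first_wake X + T.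
        (\<exists>L. declares A N X r a L) \<and>
        (\<forall>r' \<ge> r. \<forall>b \<in> team X. loc (run A N X r' b) = v))"

definition elects_leader_within :: "algorithm \<Rightarrow> nat \<Rightarrow> scenario \<Rightarrow> nat \<Rightarrow> bool" where
  "elects_leader_within A N X T \<longleftrightarrow>
     (\<exists>L \<in> team X. \<forall>a \<in> team X. \<exists>r < first_wake X + T. declares A N X r a L)"

definition smallest_label_length :: "scenario \<Rightarrow> nat" where
  "smallest_label_length X = floorlog 2 (Min (team X))"

end

theory Submission
  imports Defs
begin

text \<open>
  All agents share a sequence of \<open>B\<close> port numbers that visits every node of every graph with at most
  \<open>N\<close> nodes, whatever the starting node. A random walk misses a given node for \<open>2 N\<^sup>3\<close> steps with
  probability at most \<open>1/2\<close>, so a sequence of polynomial length exists by a union bound over all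
  graphs, and it can be found by exhaustive search.

  On waking up, an agent makes a tour: it follows the sequence and then backtracks to its starting
  node. So all agents wake up within \<open>B\<close> rounds of each other, and time can be divided into slots of
  length \<open>4 B\<close> such that a tour in the middle half of a slot happens, for every other agent, within
  the slot of the same number. An agent that stays at its starting node in a slot notices a change in
  the number of agents there if and only if somebody tours in that slot. Hence every slot broadcasts
  one bit, the disjunction of the wishes of all agents to tour. In slot \<open>j\<close> an agent tours if and only
  if bit \<open>j\<close> of a prefix-free code of its label is set and all earlier slots agree with its code.
  The bits that all agents hear then spell the code of a single label, that of the leader.

  Finally the leader performs one step of the sequence per slot, without backtracking. An agent
  that is visited for the first time knows from the number of the slot how far the leader has got.
  The ports used depend only on this number, so from then on the agent can follow the leader blindly,
  and all agents end up at the last node of the leader's walk.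
\<close>

section \<open>Universal traversal sequences of polynomial length\<close>

primrec walk :: "('s \<Rightarrow> nat \<Rightarrow> 's) \<Rightarrow> (nat \<Rightarrow> nat) \<Rightarrow> 's \<Rightarrow> nat \<Rightarrow> 's" where
  "walk \<sigma> x s 0 = s"
| "walk \<sigma> x s (Suc i) = \<sigma> (walk \<sigma> x s i) (x i)"

lemma walk_Suc_shift: "walk \<sigma> x s (Suc i) = walk \<sigma> (\<lambda>j. x (Suc j)) (\<sigma> s (x 0)) i"
  by (induction i) auto

text \<open>The probability that a walk from \<open>u\<close> driven by independent uniform symbols
  below \<open>N\<close> avoids \<open>v\<close> at all times up to \<open>t\<close>. Conditioning
  on the first symbol makes it a plain recursion, without a probability space.\<close>

primrec miss_prob :: "nat \<Rightarrow> ('s \<Rightarrow> nat \<Rightarrow> 's) \<Rightarrow> 's \<Rightarrow> nat \<Rightarrow> 's \<Rightarrow> real" where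
  "miss_prob N \<sigma> v 0 u = of_bool (u \<noteq> v)"
| "miss_prob N \<sigma> v (Suc t) u =
     (if u = v then 0 else (\<Sum>x<N. miss_prob N \<sigma> v t (\<sigma> u x)) / real N)"

lemma miss_prob_target [simp]: "miss_prob N \<sigma> v t v = 0"
  by (cases t) auto

lemma miss_prob_nonneg: "0 \<le> miss_prob N \<sigma> v t u"
  by (induction t arbitrary: u) (auto intro!: divide_nonneg_nonneg sum_nonneg)

lemma miss_prob_Suc_le:
  assumes "0 < N"
  shows "miss_prob N \<sigma> v (Suc t) u \<le> miss_prob N \<sigma> v t u"
proof (induction t arbitrary: u)
  case 0
  have "(\<Sum>x<N. (of_bool (\<sigma> u x \<noteq> v) :: real)) \<le> (\<Sum>x<N. 1)"
    by (rule sum_mono) auto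
  with assms show ?case by (simp add: field_simps)
next
  case (Suc t)
  have "(\<Sum>x<N. miss_prob N \<sigma> v (Suc t) (\<sigma> u x)) \<le> (\<Sum>x<N. miss_prob N \<sigma> v t (\<sigma> u x))"
    by (rule sum_mono) (rule Suc)
  hence "(\<Sum>x<N. miss_prob N \<sigma> v (Suc t) (\<sigma> u x)) / N \<le> (\<Sum>x<N. miss_prob N \<sigma> v t (\<sigma> u x)) / N"
    by (rule divide_right_mono) simp
  then show ?case by (simp only: miss_prob.simps(2)[of N \<sigma> v "Suc t"] miss_prob.simps(2)[of N \<sigma> v t u]) simp
qed

lemma miss_prob_antimono:
  assumes "0 < N" "s \<le> t"
  shows "miss_prob N \<sigma> v t u \<le> miss_prob N \<sigma> v s u"
  using assms(2) by (induction t rule: dec_induct) (auto intro: order_trans[OF miss_prob_Suc_le[OF assms(1)]] simp del: miss_prob.simps)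

text \<open>Symmetry of the transition matrix lets flows between two states of a set cancel.
  \<open>connected\<close> forbids a proper nonempty part of \<open>C\<close> closed under steps; it
  is applied to superlevel sets of hitting times.\<close>

locale symmetric_walk =
  fixes N :: nat and \<sigma> :: "'s \<Rightarrow> nat \<Rightarrow> 's" and C :: "'s set"
  assumes pos: "0 < N"
    and finite_C: "finite C"
    and closed: "\<lbrakk>u \<in> C; x < N\<rbrakk> \<Longrightarrow> \<sigma> u x \<in> C"
    and symmetric: "\<lbrakk>u \<in> C; w \<in> C\<rbrakk> \<Longrightarrow> card {x. x < N \<and> \<sigma> u x = w} = card {x. x < N \<and> \<sigma> w x = u}"
    and connected: "\<lbrakk>U \<subseteq> C; U \<noteq> {}; U \<noteq> C\<rbrakk> \<Longrightarrow> \<exists>u\<in>U. \<exists>x<N. \<sigma> u x \<notin> U"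
begin

text \<open>As \<open>miss_prob N \<sigma> v i u\<close> is the probability that the hitting time
  exceeds \<open>i\<close>, this is the expected minimum of the hitting time and \<open>t\<close>.
  Truncation avoids any question of convergence.\<close>

definition truncated_hitting_time :: "'s \<Rightarrow> nat \<Rightarrow> 's \<Rightarrow> real" where
  "truncated_hitting_time v t u = (\<Sum>i<t. miss_prob N \<sigma> v i u)"

lemma truncated_hitting_time_target [simp]: "truncated_hitting_time v t v = 0"
  by (simp add: truncated_hitting_time_def)

text \<open>First-step analysis. It gives an equation with \<open>Suc t\<close> on the left, and
  returning to \<open>t\<close> there turns it into an inequality.\<close>

lemma truncated_hitting_time_step:
  assumes "u \<noteq> v"
  shows "real N * truncated_hitting_time v t u \<le> N + (\<Sum>x<N. truncated_hitting_time v t (\<sigma> u x))"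
proof -
  have "truncated_hitting_time v t u \<le> truncated_hitting_time v (Suc t) u"
    by (simp add: truncated_hitting_time_def miss_prob_nonneg del: miss_prob.simps)
  also have "\<dots> = 1 + (\<Sum>i<t. (\<Sum>x<N. miss_prob N \<sigma> v i (\<sigma> u x)) / N)"
    using assms unfolding truncated_hitting_time_def by (subst sum.lessThan_Suc_shift) (simp del: sum.lessThan_Suc)
  also have "\<dots> = 1 + (\<Sum>x<N. truncated_hitting_time v t (\<sigma> u x)) / N"
    unfolding truncated_hitting_time_def sum_divide_distrib[symmetric]
    by (subst sum.swap) simp
  finally show ?thesis using pos by (simp add: field_simps)
qed

lemma sum_steps:
  assumes "u \<in> C"
  shows "(\<Sum>x<N. f (\<sigma> u x)) = (\<Sum>w\<in>C. real (card {x. x < N \<and> \<sigma> u x = w}) * f w)"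
proof -
  have "(\<Sum>x<N. f (\<sigma> u x)) = (\<Sum>w\<in>C. sum (\<lambda>x. f (\<sigma> u x)) {x\<in>{..<N}. \<sigma> u x = w})"
    by (rule sum.group[symmetric]) (use closed assms finite_C in auto)
  also have "\<dots> = (\<Sum>w\<in>C. real (card {x. x < N \<and> \<sigma> u x = w}) * f w)"
    by (intro sum.cong refl) simp
  finally show ?thesis .
qed

text \<open>
  Each node of the superlevel set above \<open>\<theta>\<close> has net outflow at most \<open>N\<close>, and inside the set the flows
  cancel, so no edge leaving the set carries more than \<open>N\<close> times its size.
\<close>

lemma cut_bound:
  assumes "0 \<le> \<theta>"
    and u: "u \<in> C" "\<theta> < truncated_hitting_time v t u"
    and x: "x < N" "truncated_hitting_time v t (\<sigma> u x) \<le> \<theta>"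
  shows "truncated_hitting_time v t u \<le> \<theta> + N * card C"
proof -
  let ?h = "truncated_hitting_time v t"
  define U where "U = {u \<in> C. \<theta> < ?h u}"
  define c where "c u w = real (card {x. x < N \<and> \<sigma> u x = w})" for u w
  have finU: "finite U" and UC: "U \<subseteq> C" using finite_C by (auto simp: U_def)
  have vU: "v \<notin> U" using assms(1) by (auto simp: U_def)
  have c_nonneg: "0 \<le> c a b" for a b by (simp add: c_def)
  have row: "(\<Sum>w\<in>C. c a w) = N" if "a \<in> C" for a
    using sum_steps[OF that, of "\<lambda>_. 1"] by (simp add: c_def)
  have flow: "(\<Sum>w\<in>C. c a w * (?h a - ?h w)) \<le> N" if "a \<in> U" for a
  proof -
    from that UC vU have a: "a \<in> C" "a \<noteq> v" by auto
    have "(\<Sum>w\<in>C. c a w * (?h a - ?h w)) = (\<Sum>w\<in>C. c a w) * ?h a - (\<Sum>w\<in>C. c a w * ?h w)"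
      by (simp add: algebra_simps sum_subtractf sum_distrib_right)
    also have "\<dots> = N * ?h a - (\<Sum>x<N. ?h (\<sigma> a x))"
      using row[OF a(1)] sum_steps[OF a(1), of ?h] by (simp add: c_def)
    finally show ?thesis using truncated_hitting_time_step[OF a(2), of t] by linarith
  qed
  have inner: "(\<Sum>a\<in>U. \<Sum>w\<in>U. c a w * (?h a - ?h w)) = 0"
  proof -
    have "(\<Sum>a\<in>U. \<Sum>w\<in>U. c a w * (?h a - ?h w)) = (\<Sum>w\<in>U. \<Sum>a\<in>U. c a w * (?h a - ?h w))"
      by (rule sum.swap)
    also have "\<dots> = (\<Sum>w\<in>U. \<Sum>a\<in>U. - (c w a * (?h w - ?h a)))"
      using UC by (intro sum.cong refl) (auto simp: c_def symmetric algebra_simps subset_iff)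
    also have "\<dots> = - (\<Sum>a\<in>U. \<Sum>w\<in>U. c a w * (?h a - ?h w))"
      by (simp add: sum_negf)
    finally show ?thesis by simp
  qed
  have uU: "u \<in> U" using u by (simp add: U_def)
  define w where "w = \<sigma> u x"
  have wC: "w \<in> C - U" using closed[OF u(1) x(1)] x(2) by (auto simp: U_def w_def)
  have "1 \<le> c u w"
  proof -
    have "0 < card {y. y < N \<and> \<sigma> u y = w}" using x by (subst card_gt_0_iff) (auto simp: w_def)
    thus ?thesis by (simp add: c_def)
  qed
  have term_nonneg: "0 \<le> c a b * (?h a - ?h b)" if "a \<in> U" "b \<in> C - U" for a b
    using that c_nonneg by (auto simp: U_def intro!: mult_nonneg_nonneg)
  \<comment> \<open>Some symbol leads from \<open>u\<close> to \<open>w\<close>, so the drop along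
    this one step is a single part of the outflow of \<open>U\<close>, whose other terms are
    nonnegative.\<close>
  have "?h u - ?h w \<le> c u w * (?h u - ?h w)"
    using \<open>1 \<le> c u w\<close> u(2) x(2) mult_right_mono[of 1 "c u w" "?h u - ?h w"] by (simp add: w_def)
  also have "\<dots> \<le> (\<Sum>b\<in>C - U. c u b * (?h u - ?h b))"
    by (rule member_le_sum) (use wC finite_C term_nonneg uU in auto)
  also have "\<dots> \<le> (\<Sum>a\<in>U. \<Sum>b\<in>C - U. c a b * (?h a - ?h b))"
    by (rule member_le_sum[of u U "\<lambda>a. \<Sum>b\<in>C - U. c a b * (?h a - ?h b)"])
       (use finU term_nonneg uU in \<open>auto intro!: sum_nonneg\<close>)
  also have "\<dots> = (\<Sum>a\<in>U. \<Sum>b\<in>C. c a b * (?h a - ?h b))"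
  proof -
    have "(\<Sum>b\<in>C. c a b * (?h a - ?h b)) =
      (\<Sum>b\<in>C - U. c a b * (?h a - ?h b)) + (\<Sum>b\<in>U. c a b * (?h a - ?h b))" for a
      using sum.subset_diff[OF UC finite_C, of "\<lambda>b. c a b * (?h a - ?h b)"] by simp
    then show ?thesis using inner by (simp add: sum.distrib)
  qed
  also have "\<dots> \<le> (\<Sum>a\<in>U. real N)" by (rule sum_mono) (rule flow)
  also have "\<dots> \<le> real N * card C"
    using card_mono[OF finite_C UC] by (simp add: mult.commute mult_left_mono)
  finally show ?thesis using x(2) by (simp add: w_def)
qed

text \<open>Raise a threshold in stages of \<open>N * card C\<close>. While the superlevel set is
  nonempty, connectedness gives a step leaving it, and \<open>cut_bound\<close> puts the origin of
  that step below the next threshold. So each stage gains a state, and \<open>card C\<close> stages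
  suffice.\<close>

lemma truncated_hitting_time_le:
  assumes "v \<in> C" "u \<in> C"
  shows "truncated_hitting_time v t u \<le> real N * (card C)\<^sup>2"
proof -
  let ?h = "truncated_hitting_time v t"
  let ?A = "\<lambda>j::nat. {u \<in> C. ?h u \<le> real j * (N * card C)}"
  have "min (card C) (Suc j) \<le> card (?A j)" for j
  proof (induction j)
    case 0
    have "card {v} \<le> card (?A 0)"
      by (rule card_mono) (use finite_C assms in auto)
    then show ?case by simp
  next
    case (Suc j)
    have mono: "?A j \<subseteq> ?A (Suc j)"
    proof
      fix a assume a: "a \<in> ?A j"
      have "real j * (N * card C) \<le> real (Suc j) * (N * card C)" by (rule mult_right_mono) auto
      with a show "a \<in> ?A (Suc j)" by auto
    qed
    show ?case
    proof (cases "?A j = C")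
      case True
      then have "?A (Suc j) = C" using mono by blast
      then show ?thesis by simp
    next
      case False
      define U where "U = C - ?A j"
      have "U \<noteq> {}" "U \<subseteq> C" using False by (auto simp: U_def)
      moreover have "v \<notin> U" by (simp add: U_def assms)
      hence "U \<noteq> C" using assms by blast
      ultimately obtain a x where a: "a \<in> U" "x < N" "\<sigma> a x \<notin> U" using connected by metis
      have "\<sigma> a x \<in> C" using a closed by (auto simp: U_def)
      have "?h a \<le> real j * (N * card C) + N * card C"
        by (rule cut_bound) (use a \<open>\<sigma> a x \<in> C\<close> in \<open>auto simp: U_def\<close>)
      then have "a \<in> ?A (Suc j)" using a by (auto simp: U_def algebra_simps)
      moreover have "a \<notin> ?A j" using a by (auto simp: U_def)
      ultimately have "?A j \<subset> ?A (Suc j)" using mono by blast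
      then have "card (?A j) < card (?A (Suc j))"
        using finite_C by (intro psubset_card_mono) auto
      then show ?thesis using Suc by linarith
    qed
  qed
  from this[of "card C"] have "card C \<le> card (?A (card C))" by simp
  then have "?A (card C) = C"
    by (intro card_seteq) (use finite_C in auto)
  with assms(2) have "?h u \<le> real (card C) * (N * card C)" by blast
  then show ?thesis by (simp add: power2_eq_square mult_ac)
qed

text \<open>Markov's inequality: \<open>2 * N ^ 3\<close> is twice the bound on the expected
  truncated hitting time.\<close>

lemma miss_prob_half:
  assumes "v \<in> C" "u \<in> C" "card C \<le> N"
  shows "miss_prob N \<sigma> v (2 * N ^ 3) u \<le> 1 / 2"
proof -
  define t where "t = 2 * N ^ 3"
  have "real t * miss_prob N \<sigma> v t u = (\<Sum>i<t. miss_prob N \<sigma> v t u)" by simp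
  also have "\<dots> \<le> truncated_hitting_time v t u"
    unfolding truncated_hitting_time_def
    by (rule sum_mono) (auto intro: miss_prob_antimono[OF pos])
  also have "\<dots> \<le> real N * (card C)\<^sup>2" using truncated_hitting_time_le assms by blast
  also have "\<dots> \<le> real N * N\<^sup>2"
    using assms(3) by (intro mult_left_mono) (auto intro!: power_mono)
  also have "\<dots> = real t / 2" by (simp add: t_def eval_nat_numeral)
  finally have "real t * (miss_prob N \<sigma> v t u - 1 / 2) \<le> 0" by (simp add: algebra_simps)
  moreover have "0 < real t" using pos by (simp add: t_def)
  ultimately show ?thesis by (simp add: t_def mult_le_0_iff)
qed

text \<open>The Markov property: after \<open>s\<close> steps the walk restarts at some state of
  \<open>C\<close>, where the uniform bound \<open>c\<close> applies.\<close>

lemma miss_prob_add_le: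
  assumes "\<And>u. u \<in> C \<Longrightarrow> miss_prob N \<sigma> v t u \<le> c" "0 \<le> c" "u \<in> C"
  shows "miss_prob N \<sigma> v (s + t) u \<le> c * miss_prob N \<sigma> v s u"
  using assms(3)
proof (induction s arbitrary: u)
  case 0
  then show ?case using assms(1)[of u] by auto
next
  case (Suc s)
  have "(\<Sum>x<N. miss_prob N \<sigma> v (s + t) (\<sigma> u x)) \<le> (\<Sum>x<N. c * miss_prob N \<sigma> v s (\<sigma> u x))"
    by (rule sum_mono) (use Suc closed in auto)
  then have "(\<Sum>x<N. miss_prob N \<sigma> v (s + t) (\<sigma> u x)) / N \<le> c * (\<Sum>x<N. miss_prob N \<sigma> v s (\<sigma> u x)) / N"
    by (intro divide_right_mono) (auto simp: sum_distrib_left)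
  then show ?case by simp
qed

lemma miss_prob_le:
  assumes "v \<in> C" "u \<in> C" "card C \<le> N"
  shows "miss_prob N \<sigma> v (K * (2 * N ^ 3)) u \<le> (1 / 2) ^ K"
  using assms(2)
proof (induction K arbitrary: u)
  case 0
  then show ?case by simp
next
  case (Suc K)
  have "miss_prob N \<sigma> v (2 * N ^ 3 + K * (2 * N ^ 3)) u \<le>
      (1 / 2) ^ K * miss_prob N \<sigma> v (2 * N ^ 3) u"
    by (rule miss_prob_add_le) (use Suc in auto)
  also have "\<dots> \<le> (1 / 2) ^ K * (1 / 2)"
    using miss_prob_half[OF assms(1) Suc.prems assms(3)] by (intro mult_left_mono) auto
  finally show ?case by simp
qed

end

text \<open>Method of conditional expectations.\<close>

lemma exists_walk_hitting:
  fixes \<sigma> :: "'i \<Rightarrow> 's \<Rightarrow> nat \<Rightarrow> 's"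
  assumes "0 < N" "finite I"
  shows "\<exists>x. (\<forall>j. x j < N) \<and>
    real (card {i \<in> I. \<forall>j\<le>t. walk (\<sigma> i) x (u i) j \<noteq> v i}) \<le> (\<Sum>i\<in>I. miss_prob N (\<sigma> i) (v i) t (u i))"
  using assms(2)
proof (induction t arbitrary: I u)
  case 0
  have "real (card {i \<in> I. u i \<noteq> v i}) = (\<Sum>i\<in>I. of_bool (u i \<noteq> v i))"
    using 0 by (simp add: of_bool_def sum.If_cases Int_def)
  then show ?case using assms(1) by (intro exI[of _ "\<lambda>_. 0"]) simp
next
  case (Suc t)
  define J where "J = {i \<in> I. u i \<noteq> v i}"
  define f where "f y = (\<Sum>i\<in>J. miss_prob N (\<sigma> i) (v i) t (\<sigma> i (u i) y))" for y
  have "(\<Sum>i\<in>I. miss_prob N (\<sigma> i) (v i) (Suc t) (u i)) =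
      (\<Sum>i\<in>J. (\<Sum>y<N. miss_prob N (\<sigma> i) (v i) t (\<sigma> i (u i) y)) / N)"
    using Suc.prems unfolding J_def by (intro sum.mono_neutral_cong_right) auto
  also have "\<dots> = (\<Sum>y<N. f y) / N"
    unfolding f_def sum_divide_distrib[symmetric] by (subst sum.swap) simp
  finally have eq: "(\<Sum>i\<in>I. miss_prob N (\<sigma> i) (v i) (Suc t) (u i)) = (\<Sum>y<N. f y) / N" .
  \<comment> \<open>Some first symbol does no worse than the average; fixing it keeps the expected
    number of missed targets under the bound.\<close>
  have "\<exists>y<N. f y \<le> (\<Sum>y<N. f y) / N"
  proof (rule ccontr)
    assume "\<not> ?thesis"
    then have "(\<Sum>y<N. (\<Sum>y<N. f y) / N) < (\<Sum>y<N. f y)"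
      using assms(1) by (intro sum_strict_mono) (auto simp: not_le lessThan_empty_iff)
    then show False using assms(1) by simp
  qed
  then obtain y where y: "y < N" "f y \<le> (\<Sum>y<N. f y) / N" by blast
  have "finite J" using Suc.prems by (simp add: J_def)
  from Suc.IH[OF this, of "\<lambda>i. \<sigma> i (u i) y"] obtain x where x: "\<forall>j. x j < N"
    "real (card {i \<in> J. \<forall>j\<le>t. walk (\<sigma> i) x (\<sigma> i (u i) y) j \<noteq> v i}) \<le> f y"
    unfolding f_def by blast
  define x' where "x' = case_nat y x"
  have "(\<forall>j\<le>Suc t. walk (\<sigma> i) x' (u i) j \<noteq> v i) \<longleftrightarrow>
      u i \<noteq> v i \<and> (\<forall>j\<le>t. walk (\<sigma> i) x (\<sigma> i (u i) y) j \<noteq> v i)" for i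
  proof -
    have "walk (\<sigma> i) x' (u i) (Suc j) = walk (\<sigma> i) x (\<sigma> i (u i) y) j" for j
      unfolding walk_Suc_shift by (simp add: x'_def)
    then show ?thesis
      by (metis Suc_le_mono nat.exhaust walk.simps(1) zero_le)
  qed
  then have "{i \<in> I. \<forall>j\<le>Suc t. walk (\<sigma> i) x' (u i) j \<noteq> v i} =
      {i \<in> J. \<forall>j\<le>t. walk (\<sigma> i) x (\<sigma> i (u i) y) j \<noteq> v i}"
    by (auto simp: J_def)
  moreover have "\<forall>j. x' j < N" using x y by (auto simp: x'_def split: nat.split)
  ultimately show ?case using x(2) y(2) eq by (intro exI[of _ x']) auto
qed

section \<open>Symbol sequences and transition tables as numbers in base \<open>N\<close>\<close>

definition digit :: "nat \<Rightarrow> nat \<Rightarrow> nat \<Rightarrow> nat" where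
  "digit N k i = k div N ^ i mod N"

lemma digit_less: "0 < N \<Longrightarrow> digit N k i < N"
  by (simp add: digit_def)

lemma exists_digits:
  assumes "\<And>i. i < m \<Longrightarrow> d i < N"
  shows "\<exists>k<N ^ m. \<forall>i<m. digit N k i = d i"
  using assms
proof (induction m arbitrary: d)
  case 0
  then show ?case by simp
next
  case (Suc m)
  from Suc.IH[of "\<lambda>i. d (Suc i)"] Suc.prems obtain k
    where k: "k < N ^ m" "\<And>i. i < m \<Longrightarrow> digit N k i = d (Suc i)" by auto
  have d0: "d 0 < N" using Suc.prems by simp
  have "d 0 + N * k < N * Suc k" using d0 by simp
  also have "\<dots> \<le> N * N ^ m" using k(1) by (intro mult_le_mono) auto
  finally have "d 0 + N * k < N ^ Suc m" by simp
  moreover have "digit N (d 0 + N * k) i = d i" if "i < Suc m" for i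
    using that d0 k(2) by (cases i) (auto simp: digit_def div_mult2_eq)
  ultimately show ?case by blast
qed

text \<open>Every \<open>2 * N ^ 3\<close> steps halve the miss probability. There are at most
  \<open>N ^ (N * N + 2)\<close>, hence at most \<open>2 ^ (N ^ 3 + 2 * N)\<close>, triples of
  table, start and target; one halving more brings the union bound below 1.\<close>

definition exploration_length :: "nat \<Rightarrow> nat" where
  "exploration_length N = (N ^ 3 + 2 * N + 1) * (2 * N ^ 3)"

text \<open>The digits of \<open>g\<close> list an \<open>N\<close> by \<open>N\<close> transition
  table row by row, so that quantifying over graphs becomes quantifying over numbers below
  \<open>N ^ (N * N)\<close>.\<close>

definition table_step :: "nat \<Rightarrow> nat \<Rightarrow> nat \<Rightarrow> nat \<Rightarrow> nat" where
  "table_step N g v p = digit N g (v * N + p)"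

definition symmetric_table :: "nat \<Rightarrow> nat \<Rightarrow> bool" where
  "symmetric_table N g \<longleftrightarrow> (\<forall>v<N. \<forall>w<N.
     card {p. p < N \<and> table_step N g v p = w} = card {p. p < N \<and> table_step N g w p = v})"

text \<open>The nodes visited are closed under taking steps, so they form a whole connected component.\<close>

definition universal :: "nat \<Rightarrow> nat \<Rightarrow> bool" where
  "universal N k \<longleftrightarrow> (\<forall>g < N ^ (N * N). symmetric_table N g \<longrightarrow>
     (\<forall>s<N. \<forall>i<Suc (exploration_length N). \<forall>p<N. \<exists>j<Suc (exploration_length N).
        walk (table_step N g) (digit N k) s j = table_step N g (walk (table_step N g) (digit N k) s i) p))"

definition reachable :: "nat \<Rightarrow> ('s \<Rightarrow> nat \<Rightarrow> 's) \<Rightarrow> 's \<Rightarrow> 's set" where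
  "reachable N \<sigma> s = {t. (s, t) \<in> {(u, w). \<exists>x<N. w = \<sigma> u x}\<^sup>*}"

lemma reachable_self: "s \<in> reachable N \<sigma> s"
  by (simp add: reachable_def)

lemma reachable_step: "u \<in> reachable N \<sigma> s \<Longrightarrow> x < N \<Longrightarrow> \<sigma> u x \<in> reachable N \<sigma> s"
  unfolding reachable_def by (auto intro: rtrancl_into_rtrancl)

lemma walk_reachable: "\<forall>j. x j < N \<Longrightarrow> walk \<sigma> x s i \<in> reachable N \<sigma> s"
  by (induction i) (auto intro: reachable_self reachable_step)

lemma table_step_less: "0 < N \<Longrightarrow> table_step N g v p < N"
  by (simp add: table_step_def digit_less)

lemma reachable_table:
  assumes "s < N"
  shows "reachable N (table_step N g) s \<subseteq> {..<N}"
proof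
  fix t assume "t \<in> reachable N (table_step N g) s"
  then have "(s, t) \<in> {(u, w). \<exists>x<N. w = table_step N g u x}\<^sup>*" by (simp add: reachable_def)
  then show "t \<in> {..<N}"
    by (induction rule: rtrancl_induct) (use assms in \<open>auto intro: table_step_less\<close>)
qed

text \<open>For connectedness, symmetry provides a reverse for every step, so a set closed under
  steps is also closed under predecessors. If nonempty, it contains \<open>s\<close> and therefore
  everything reachable.\<close>

lemma symmetric_walk_table:
  assumes "symmetric_table N g" "s < N"
  shows "symmetric_walk N (table_step N g) (reachable N (table_step N g) s)"
proof
  let ?C = "reachable N (table_step N g) s"
  have CN: "?C \<subseteq> {..<N}" by (rule reachable_table) fact
  show "0 < N" using assms(2) by simp
  show "finite ?C" using CN finite_subset by blast
  show "table_step N g u x \<in> ?C" if "u \<in> ?C" "x < N" for u x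
    using that by (rule reachable_step)
  show sym: "card {x. x < N \<and> table_step N g u x = w} = card {x. x < N \<and> table_step N g w x = u}"
    if "u \<in> ?C" "w \<in> ?C" for u w
    using assms(1) that CN by (auto simp: symmetric_table_def)
  show "\<exists>u\<in>U. \<exists>x<N. table_step N g u x \<notin> U" if U: "U \<subseteq> ?C" "U \<noteq> {}" "U \<noteq> ?C" for U
  proof (rule ccontr)
    assume "\<not> ?thesis"
    then have cl: "\<And>u x. u \<in> U \<Longrightarrow> x < N \<Longrightarrow> table_step N g u x \<in> U" by blast
    have backward: "w \<in> U" if "table_step N g w x \<in> U" "x < N" "w \<in> ?C" for w x
    proof -
      have "0 < card {y. y < N \<and> table_step N g w y = table_step N g w x}"
        using that by (subst card_gt_0_iff) auto
      also have "\<dots> = card {y. y < N \<and> table_step N g (table_step N g w x) y = w}"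
        by (rule sym) (use that U in auto)
      finally have "{y. y < N \<and> table_step N g (table_step N g w x) y = w} \<noteq> {}"
        by (metis card.empty less_irrefl)
      then obtain y where "y < N" "table_step N g (table_step N g w x) y = w" by blast
      then show ?thesis using cl[OF that(1)] by metis
    qed
    obtain u where u: "u \<in> U" using U by blast
    have "s \<in> U"
    proof -
      have "(s, u) \<in> {(u, w). \<exists>x<N. w = table_step N g u x}\<^sup>*"
        using u U by (auto simp: reachable_def)
      then have "u \<in> U \<longrightarrow> s \<in> U"
      proof (induction rule: rtrancl_induct)
        case (step y z)
        have "y \<in> ?C" using step by (auto simp: reachable_def)
        with step backward show ?case by auto
      qed simp
      with u show ?thesis by blast
    qed
    have "?C \<subseteq> U"
    proof
      fix t assume "t \<in> ?C"
      then have "(s, t) \<in> {(u, w). \<exists>x<N. w = table_step N g u x}\<^sup>*" by (simp add: reachable_def)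
      then show "t \<in> U" by (induction rule: rtrancl_induct) (use \<open>s \<in> U\<close> cl in auto)
    qed
    with U show False by blast
  qed
qed

lemma walk_cong: "(\<And>j. j < i \<Longrightarrow> x j = y j) \<Longrightarrow> walk \<sigma> x s i = walk \<sigma> y s i"
  by (induction i) auto

text \<open>Union bound: fewer than \<open>2 ^ K\<close> triples, each missed with probability at
  most \<open>(1 / 2) ^ K\<close>, give an expected number of misses below 1. So some sequence
  misses none, and only its first \<open>t\<close> symbols matter.\<close>

lemma exists_universal: "\<exists>k. universal N k"
proof (cases "N = 0")
  case True
  then show ?thesis by (simp add: universal_def)
next
  case False
  define K where "K = N ^ 3 + 2 * N + 1"
  define t where "t = exploration_length N"
  have t: "t = K * (2 * N ^ 3)" by (simp add: t_def K_def exploration_length_def)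
  define I where "I = {(g, s, v). g < N ^ (N * N) \<and> s < N \<and> symmetric_table N g \<and>
      v \<in> reachable N (table_step N g) s}"
  have sub: "I \<subseteq> {..<N ^ (N * N)} \<times> {..<N} \<times> {..<N}"
    using reachable_table by (fastforce simp: I_def)
  then have finI: "finite I" by (rule finite_subset) auto
  have "card I \<le> N ^ (N * N) * (N * N)"
    using card_mono[OF _ sub] by simp
  also have "\<dots> = N ^ (N * N + 2)" by (simp add: power_add power2_eq_square)
  also have "\<dots> \<le> (2 ^ N) ^ (N * N + 2)"
    by (intro power_mono) (auto intro: less_imp_le)
  also have "\<dots> = 2 ^ (N * (N * N + 2))" by (simp only: power_mult)
  also have "N * (N * N + 2) = N ^ 3 + 2 * N" by (simp add: power3_eq_cube algebra_simps)
  also have "2 ^ (N ^ 3 + 2 * N) < (2::nat) ^ K" by (simp add: K_def)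
  finally have cardI: "real (card I) < 2 ^ K" by (metis of_nat_less_iff of_nat_numeral of_nat_power)
  obtain x where x: "\<forall>j. x j < N" and
    miss: "real (card {i \<in> I. \<forall>j\<le>t. walk (table_step N (fst i)) x (fst (snd i)) j \<noteq> snd (snd i)})
      \<le> (\<Sum>i\<in>I. miss_prob N (table_step N (fst i)) (snd (snd i)) t (fst (snd i)))"
    using exists_walk_hitting[of N I t "\<lambda>i. table_step N (fst i)" "\<lambda>i. fst (snd i)" "\<lambda>i. snd (snd i)"]
      finI False by auto
  note miss
  also have "\<dots> \<le> (\<Sum>i\<in>I. (1 / 2) ^ K)"
  proof (rule sum_mono)
    fix i assume "i \<in> I"
    then obtain g s v where i: "i = (g, s, v)" "s < N" "symmetric_table N g"
      "v \<in> reachable N (table_step N g) s" by (auto simp: I_def)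
    interpret symmetric_walk N "table_step N g" "reachable N (table_step N g) s"
      using i by (intro symmetric_walk_table)
    have "card (reachable N (table_step N g) s) \<le> N"
      using card_mono[OF _ reachable_table[OF i(2), of g]] by simp
    then show "miss_prob N (table_step N (fst i)) (snd (snd i)) t (fst (snd i)) \<le> (1 / 2) ^ K"
      using miss_prob_le[OF i(4) reachable_self, of K] i(1) t by simp
  qed
  also have "\<dots> < 1" using cardI by (simp add: field_simps power_one_over)
  finally have "card {i \<in> I. \<forall>j\<le>t. walk (table_step N (fst i)) x (fst (snd i)) j \<noteq> snd (snd i)} = 0"
    by simp
  then have hit: "\<exists>j\<le>t. walk (table_step N g) x s j = v" if "(g, s, v) \<in> I" for g s v
    using finI that by fastforce
  obtain k where k: "\<And>j. j < t \<Longrightarrow> digit N k j = x j"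
    using exists_digits[of t x N] x by blast
  have "universal N k"
    unfolding universal_def t_def[symmetric]
  proof (intro allI impI)
    fix g s i p assume g: "g < N ^ (N * N)" "symmetric_table N g" and s: "s < N" and "p < N" "i < Suc t"
    let ?w = "walk (table_step N g) (digit N k) s"
    have "?w i \<in> reachable N (table_step N g) s"
      by (rule walk_reachable) (use False digit_less in auto)
    then have "table_step N g (?w i) p \<in> reachable N (table_step N g) s"
      using \<open>p < N\<close> by (rule reachable_step)
    then obtain j where j: "j \<le> t" "walk (table_step N g) x s j = table_step N g (?w i) p"
      using hit g s by (force simp: I_def)
    have "?w j = walk (table_step N g) x s j"
      by (rule walk_cong) (use k j in auto)
    with j show "\<exists>j<Suc t. ?w j = table_step N g (?w i) p" by (metis less_Suc_eq_le)
  qed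
  then show ?thesis ..
qed

text \<open>Taking the least index makes the sequence a function of \<open>N\<close> alone that
  unbounded search computes, so all agents agree on it.\<close>

definition exploration :: "nat \<Rightarrow> nat \<Rightarrow> nat" where
  "exploration N = digit N (LEAST k. universal N k)"

lemma universal_exploration:
  assumes "g < N ^ (N * N)" "symmetric_table N g" "s < N" "i \<le> exploration_length N" "p < N"
  shows "\<exists>j\<le>exploration_length N. walk (table_step N g) (exploration N) s j =
    table_step N g (walk (table_step N g) (exploration N) s i) p"
proof -
  have "universal N (LEAST k. universal N k)" using exists_universal by (rule LeastI_ex)
  with assms show ?thesis unfolding universal_def exploration_def less_Suc_eq_le by blast
qed

lemma exploration_less: "0 < N \<Longrightarrow> exploration N i < N"
  by (simp add: exploration_def digit_less)

text \<open>This matches the effect of \<open>Move p\<close> in \<open>perform\<close>. A missing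
  port acts as a self-loop, so every node has exactly \<open>N\<close> steps for symbols below
  \<open>N\<close>.\<close>

definition move :: "network \<Rightarrow> nat \<Rightarrow> nat \<Rightarrow> nat" where
  "move G v p = (if p < degree_at G v then neighbour_via G v p else v)"

section \<open>Networks as transition tables\<close>

locale valid_net =
  fixes G :: network
  assumes valid: "valid_network G"
begin

lemma finite_nodes: "finite (nodes G)"
  using valid by (simp add: valid_network_def)

lemma neighbours_subset: "neighbours G v \<subseteq> nodes G - {v}"
  using valid by (fastforce simp: valid_network_def neighbours_def doubleton_eq_iff)

lemma neighbours_commute: "w \<in> neighbours G v \<longleftrightarrow> v \<in> neighbours G w"
  by (simp add: neighbours_def insert_commute)

lemma port_bij: "v \<in> nodes G \<Longrightarrow> bij_betw (port G v) (neighbours G v) {..<degree_at G v}"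
  using valid by (simp add: valid_network_def)

lemma neighbour_via_port:
  assumes "v \<in> nodes G" "w \<in> neighbours G v"
  shows "neighbour_via G v (port G v w) = w"
  unfolding neighbour_via_def
  using assms port_bij[OF assms(1)] by (intro the_equality) (auto simp: bij_betw_def inj_on_def)

lemma port_less:
  assumes "v \<in> nodes G" "w \<in> neighbours G v"
  shows "port G v w < degree_at G v"
  using port_bij[OF assms(1)] assms(2) by (auto simp: bij_betw_def)

lemma neighbour_via:
  assumes "v \<in> nodes G" "p < degree_at G v"
  shows "neighbour_via G v p \<in> neighbours G v" "port G v (neighbour_via G v p) = p"
proof -
  obtain w where "w \<in> neighbours G v" "port G v w = p"
    using bij_betw_imp_surj_on[OF port_bij[OF assms(1)]] assms(2) by (metis imageE lessThan_iff)
  then show "neighbour_via G v p \<in> neighbours G v" "port G v (neighbour_via G v p) = p"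
    using neighbour_via_port[OF assms(1)] by auto
qed

lemma move_in_nodes: "v \<in> nodes G \<Longrightarrow> move G v p \<in> nodes G"
  using neighbour_via(1) neighbours_subset by (fastforce simp: move_def)

text \<open>Leaving by the observed port of entry undoes a move; the return half of a tour rests on
  this.\<close>

lemma move_back:
  assumes "v \<in> nodes G" "p < degree_at G v"
  shows "move G (move G v p) (port G (move G v p) v) = v"
proof -
  let ?w = "move G v p"
  have w: "?w \<in> neighbours G v" using neighbour_via(1)[OF assms] assms(2) by (simp add: move_def)
  then have "v \<in> neighbours G ?w" "?w \<in> nodes G"
    using neighbours_commute neighbours_subset by blast+
  then show ?thesis
    using port_less[of ?w v] neighbour_via_port[of ?w v] by (simp add: move_def[of G ?w])
qed

lemma degree_less: "v \<in> nodes G \<Longrightarrow> degree_at G v < card (nodes G)"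
  unfolding degree_at_def using neighbours_subset[of v] finite_nodes
  by (intro psubset_card_mono) auto

lemma walk_in_nodes: "v \<in> nodes G \<Longrightarrow> walk (move G) x v i \<in> nodes G"
  by (induction i) (auto intro: move_in_nodes)

text \<open>Number the nodes and write \<open>move\<close> as a symmetric table \<open>g\<close>.
  Universality makes the visited set closed under neighbours, and a connected network has only one
  such nonempty set.\<close>

lemma exploration_covers:
  assumes N: "card (nodes G) \<le> N" and v: "v \<in> nodes G" and w: "w \<in> nodes G"
  shows "\<exists>i\<le>exploration_length N. walk (move G) (exploration N) v i = w"
proof -
  define n where "n = card (nodes G)"
  obtain f where f: "bij_betw f (nodes G) {..<n}"
    using finite_nodes ex_bij_betw_finite_nat unfolding n_def atLeast0LessThan by blast
  define f' where "f' = inv_into (nodes G) f"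
  have f'f: "f' (f u) = u" if "u \<in> nodes G" for u
    unfolding f'_def using f that by (simp add: bij_betw_inv_into_left)
  have ff': "f (f' a) = a" and f'_in: "f' a \<in> nodes G" if "a < n" for a
    unfolding f'_def using f that by (auto simp: bij_betw_inv_into_right bij_betw_def inv_into_into)
  have f_less: "f u < n" if "u \<in> nodes G" for u using f that by (auto simp: bij_betw_def)
  have nN: "n \<le> N" using N by (simp add: n_def)
  have "0 < n" using f_less[OF v] by simp
  \<comment> \<open>A table always has \<open>N\<close> rows; the rows from \<open>n\<close> on are
    isolated padding with self-loops only.\<close>
  define T where "T a p = (if a < n then f (move G (f' a) p) else a)" for a p
  have T_less: "T a p < N" if "a < N" for a p
    using that nN f_less[OF move_in_nodes[OF f'_in[of a]], of p] by (auto simp: T_def)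
  obtain g where g: "g < N ^ (N * N)" "\<And>i. i < N * N \<Longrightarrow> digit N g i = T (i div N) (i mod N)"
    using exists_digits[of "N * N" "\<lambda>i. T (i div N) (i mod N)" N] T_less less_mult_imp_div_less
    by blast
  have gT: "table_step N g a p = T a p" if "a < N" "p < N" for a p
  proof -
    have "a * N + p < Suc a * N" using that by simp
    also have "\<dots> \<le> N * N" using that by (intro mult_le_mono1) auto
    finally show ?thesis using g(2)[of "a * N + p"] that by (simp add: table_step_def)
  qed
  \<comment> \<open>Between distinct nodes there is at most one port, so the number of steps is 0 or
    1 according to adjacency, a symmetric relation. Self-loops lie on the diagonal and cannot break
    symmetry.\<close>
  have adj: "card {p. p < N \<and> table_step N g a p = b} =
      of_bool (a < n \<and> b < n \<and> f' b \<in> neighbours G (f' a))" if "a < N" "b < N" "a \<noteq> b" for a b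
  proof (cases "a < n \<and> b < n \<and> f' b \<in> neighbours G (f' a)")
    case True
    let ?p = "port G (f' a) (f' b)"
    have p: "?p < degree_at G (f' a)" using True f'_in port_less by blast
    also have "\<dots> < N" using degree_less[OF f'_in[of a]] True nN by (simp add: n_def)
    finally have "?p < N" .
    have "table_step N g a p = b \<longleftrightarrow> p = ?p" if "p < N" for p
    proof
      assume "table_step N g a p = b"
      then have eq: "move G (f' a) p = f' b"
        using gT[OF \<open>a < N\<close> that] True f'f[OF move_in_nodes[OF f'_in]] by (auto simp: T_def)
      have "p < degree_at G (f' a)"
        using eq that True ff' \<open>a \<noteq> b\<close> by (metis move_def)
      then show "p = ?p" using eq neighbour_via(2)[OF f'_in[of a], of p] True by (auto simp: move_def)
    next
      assume "p = ?p"
      then show "table_step N g a p = b"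
        using gT[OF \<open>a < N\<close> that] True p neighbour_via_port[OF f'_in] ff' by (simp add: T_def move_def)
    qed
    then have "{p. p < N \<and> table_step N g a p = b} = {?p}" using \<open>?p < N\<close> by auto
    then show ?thesis using True by simp
  next
    case False
    have "table_step N g a p \<noteq> b" if "p < N" for p
    proof
      assume *: "table_step N g a p = b"
      with gT[OF \<open>a < N\<close> that] \<open>a \<noteq> b\<close> have an: "a < n" and eq: "f (move G (f' a) p) = b"
        by (auto simp: T_def split: if_splits)
      have bn: "b < n" using eq f_less[OF move_in_nodes[OF f'_in[OF an]]] by blast
      have m: "move G (f' a) p = f' b" using eq f'f[OF move_in_nodes[OF f'_in[OF an]]] by auto
      have "p < degree_at G (f' a)"
        using m ff' an bn \<open>a \<noteq> b\<close> by (metis move_def)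
      then have "f' b \<in> neighbours G (f' a)"
        using m neighbour_via(1)[OF f'_in[OF an], of p] by (simp add: move_def)
      with an bn False show False by blast
    qed
    then have "{p. p < N \<and> table_step N g a p = b} = {}" by blast
    then show ?thesis by (simp only: False card.empty of_bool_eq)
  qed
  have sym: "symmetric_table N g"
    unfolding symmetric_table_def
  proof (intro allI impI)
    fix a b assume "a < N" "b < N"
    then show "card {p. p < N \<and> table_step N g a p = b} = card {p. p < N \<and> table_step N g b p = a}"
      using adj neighbours_commute by (cases "a = b") (auto simp: conj_ac)
  qed
  let ?B = "exploration_length N"
  let ?w = "walk (move G) (exploration N) v"
  have "0 < N" using \<open>0 < n\<close> nN by simp
  have conj: "walk (table_step N g) (exploration N) (f v) i = f (?w i)" for i
  proof (induction i)
    case (Suc i)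
    have "f (?w i) < n" using f_less walk_in_nodes v by blast
    then show ?case using Suc gT[of "f (?w i)" "exploration N i"] nN exploration_less[OF \<open>0 < N\<close>]
      by (simp add: T_def f'f walk_in_nodes v)
  qed simp
  define V where "V = ?w ` {..?B}"
  have closed: "b \<in> V" if ab: "a \<in> V" "b \<in> neighbours G a" for a b
  proof -
    obtain i where i: "i \<le> ?B" "a = ?w i" using ab by (auto simp: V_def)
    have a: "a \<in> nodes G" using i walk_in_nodes v by blast
    have b: "b \<in> nodes G" using ab neighbours_subset by blast
    let ?p = "port G a b"
    have p: "?p < degree_at G a" using a ab port_less by blast
    then have "?p < N" using degree_less[OF a] N by simp
    obtain j where j: "j \<le> ?B" "walk (table_step N g) (exploration N) (f v) j =
        table_step N g (walk (table_step N g) (exploration N) (f v) i) ?p"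
      using universal_exploration[OF g(1) sym less_le_trans[OF f_less[OF v] nN] i(1) \<open>?p < N\<close>] by blast
    have "f (?w j) = T (f a) ?p"
      using j(2) gT[OF _ \<open>?p < N\<close>, of "f a"] f_less[OF a] nN by (simp add: conj i(2))
    also have "\<dots> = f b"
      using f_less[OF a] f'f[OF a] p neighbour_via_port[OF a ab(2)] by (simp add: T_def move_def)
    finally have "?w j = b" using f'f b walk_in_nodes v by metis
    with j show ?thesis by (auto simp: V_def)
  qed
  have "(v, w) \<in> {(x, y). {x, y} \<in> edges G}\<^sup>*"
    using valid v w by (simp add: valid_network_def connected_network_def)
  then have "w \<in> V"
  proof (induction rule: rtrancl_induct)
    case base
    show ?case by (auto simp: V_def intro!: image_eqI[of _ _ 0])
  next
    case (step y z)
    then show ?case using closed[of y z] by (simp add: neighbours_def)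
  qed
  then show ?thesis by (auto simp: V_def)
qed

end

section \<open>Computability of the algorithm\<close>

text \<open>
  Computability of a function of finitely many arguments, given as a function of an environment
  that holds the arguments. A binder shifts the environment: the bound variable becomes argument 0.
\<close>

definition rc :: "nat \<Rightarrow> ((nat \<Rightarrow> nat) \<Rightarrow> nat) \<Rightarrow> bool" where
  "rc n f \<longleftrightarrow> (\<exists>g. total_recursive n g \<and> (\<forall>e. f e = g (map e [0..<n])))"

lemma rcI:
  assumes "total_recursive n g" "\<And>e. f e = g (map e [0..<n])"
  shows "rc n f"
  using assms unfolding rc_def by blast

lemma rc_var: "i < n \<Longrightarrow> rc n (\<lambda>e. e i)"
  by (rule rcI[OF total_recursive.proj]) auto

lemma rc_cong_env:
  assumes "rc n f" "\<And>i. i < n \<Longrightarrow> e i = e' i"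
  shows "f e = f e'"
proof -
  have "map e [0..<n] = map e' [0..<n]" using assms(2) by simp
  then show ?thesis using assms(1) unfolding rc_def by metis
qed

lemma rc_comp:
  assumes "rc (length as) f" "\<And>a. a \<in> set as \<Longrightarrow> rc n a"
  shows "rc n (\<lambda>e. f (\<lambda>i. (as ! i) e))"
proof -
  obtain g where g: "total_recursive (length as) g" "\<And>e. f e = g (map e [0..<length as])"
    using assms(1) unfolding rc_def by blast
  obtain h where h: "\<And>a. a \<in> set as \<Longrightarrow> total_recursive n (h a)"
    "\<And>a e. a \<in> set as \<Longrightarrow> a e = h a (map e [0..<n])"
    using assms(2) unfolding rc_def by metis
  show ?thesis
  proof (rule rcI)
    show "total_recursive n (\<lambda>xs. g (map (\<lambda>k. k xs) (map h as)))"
      by (rule total_recursive.comp) (use g h in auto)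
    fix e
    have "map (\<lambda>i. (as ! i) e) [0..<length as] = map (\<lambda>k. k (map e [0..<n])) (map h as)"
      by (rule nth_equalityI) (use h in auto)
    then show "f (\<lambda>i. (as ! i) e) = g (map (\<lambda>k. k (map e [0..<n])) (map h as))"
      using g by simp
  qed
qed

lemma rc_comp1:
  assumes "rc 1 (\<lambda>e. F (e 0))" "rc n a"
  shows "rc n (\<lambda>e. F (a e))"
  using rc_comp[of "[a]" "\<lambda>e. F (e 0)" n] assms by simp

lemma rc_comp2:
  assumes "rc 2 (\<lambda>e. F (e 0) (e 1))" "rc n a" "rc n b"
  shows "rc n (\<lambda>e. F (a e) (b e))"
  using rc_comp[of "[a, b]" "\<lambda>e. F (e 0) (e 1)" n] assms by (auto simp: numeral_2_eq_2)

lemma rc_comp3: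
  assumes "rc 3 (\<lambda>e. F (e 0) (e 1) (e 2))" "rc n a" "rc n b" "rc n c"
  shows "rc n (\<lambda>e. F (a e) (b e) (c e))"
  using rc_comp[of "[a, b, c]" "\<lambda>e. F (e 0) (e 1) (e 2)" n] assms by (auto simp: numeral_3_eq_3)

lemma rc_comp4:
  assumes "rc 4 (\<lambda>e. F (e 0) (e 1) (e 2) (e 3))" "rc n a" "rc n b" "rc n c" "rc n d"
  shows "rc n (\<lambda>e. F (a e) (b e) (c e) (d e))"
  using rc_comp[of "[a, b, c, d]" "\<lambda>e. F (e 0) (e 1) (e 2) (e 3)" n] assms
  by (auto simp: eval_nat_numeral)

lemma rc_Suc:
  assumes "rc n a" shows "rc n (\<lambda>e. Suc (a e))"
proof (rule rc_comp1[of Suc, OF _ assms])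
  show "rc 1 (\<lambda>e. Suc (e 0))" by (rule rcI[OF total_recursive.succ]) simp
qed

lemma rc_const: "rc n (\<lambda>e. c)"
proof (induction c)
  case 0
  show ?case by (rule rcI[OF total_recursive.zero]) simp
next
  case (Suc c)
  then show ?case by (rule rc_Suc)
qed

lemma map_upt_shift: "map e [0..<Suc n] = e 0 # map (\<lambda>i. e (Suc i)) [0..<n]"
  by (rule map_upt_Suc)

text \<open>\<open>prim_rec\<close> recurses on the head of the argument list. Substituting
  \<open>m\<close> for the head and the variables for the rest allows recursion up to any computable
  bound.\<close>

lemma rc_rec_nat:
  assumes m: "rc n m" and f: "rc n f"
    and g: "rc (Suc (Suc n)) (\<lambda>e. g (e 0) (e (Suc 0)) (\<lambda>i. e (Suc (Suc i))))"
  shows "rc n (\<lambda>e. rec_nat (f e) (\<lambda>k r. g k r e) (m e))"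
proof -
  obtain f' where f': "total_recursive n f'" "\<And>e. f e = f' (map e [0..<n])"
    using f unfolding rc_def by blast
  obtain g' where g': "total_recursive (Suc (Suc n)) g'"
    "\<And>e. g (e 0) (e (Suc 0)) (\<lambda>i. e (Suc (Suc i))) = g' (map e [0..<Suc (Suc n)])"
    using g unfolding rc_def by blast
  have g'': "g k r e = g' (k # r # map e [0..<n])" for k r e
    using g'(2)[of "case_nat k (case_nat r e)"] by (simp add: map_upt_shift del: upt_Suc)
  let ?F = "\<lambda>e. rec_nat (f (\<lambda>i. e (Suc i))) (\<lambda>k r. g k r (\<lambda>i. e (Suc i))) (e 0)"
  have "rc (Suc n) ?F"
    by (rule rcI[OF total_recursive.prim_rec[OF f'(1) g'(1)]])
       (simp add: map_upt_shift f'(2) g'' del: upt_Suc)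
  then have "rc n (\<lambda>e. ?F (\<lambda>i. ((m # map (\<lambda>i e. e i) [0..<n]) ! i) e))"
    by (intro rc_comp) (auto intro: m rc_var)
  moreover have "f (\<lambda>i. ((m # map (\<lambda>i e. e i) [0..<n]) ! Suc i) e) = f e" for e
    by (rule rc_cong_env[OF f]) simp
  moreover have "g k r (\<lambda>i. ((m # map (\<lambda>i e. e i) [0..<n]) ! Suc i) e) = g k r e" for e k r
    unfolding g'' by (intro arg_cong[of _ _ g'] arg_cong2[of _ _ _ _ "(#)"] map_cong refl) auto
  ultimately show ?thesis by simp
qed

section \<open>Arithmetic, bounded quantifiers and search\<close>

definition rcp :: "nat \<Rightarrow> ((nat \<Rightarrow> nat) \<Rightarrow> bool) \<Rightarrow> bool" where
  "rcp n P \<longleftrightarrow> rc n (\<lambda>e. of_bool (P e))"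

lemma rc_add:
  assumes "rc n a" "rc n b" shows "rc n (\<lambda>e. a e + b e)"
proof (rule rc_comp2[of "(+)", OF _ assms])
  have "rec_nat x (\<lambda>_ r. Suc r) y = x + y" for x y by (induction y) auto
  moreover have "rc 2 (\<lambda>e. rec_nat (e 0) (\<lambda>_ r. Suc r) (e 1))"
    by (intro rc_rec_nat rc_var rc_Suc) auto
  ultimately show "rc 2 (\<lambda>e. e 0 + e 1)" by simp
qed

lemma rc_pred:
  assumes "rc n a" shows "rc n (\<lambda>e. a e - 1)"
proof (rule rc_comp1[of "\<lambda>x. x - 1", OF _ assms])
  have "rec_nat 0 (\<lambda>k _. k) x = x - 1" for x by (cases x) auto
  moreover have "rc 1 (\<lambda>e. rec_nat 0 (\<lambda>k _. k) (e 0))"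
    by (intro rc_rec_nat rc_var rc_const) auto
  ultimately show "rc 1 (\<lambda>e. e 0 - 1)" by simp
qed

lemma rc_diff:
  assumes "rc n a" "rc n b" shows "rc n (\<lambda>e. a e - b e)"
proof (rule rc_comp2[of "(-)", OF _ assms])
  have "rec_nat x (\<lambda>_ r. r - 1) y = x - y" for x y :: nat by (induction y) auto
  moreover have "rc 2 (\<lambda>e. rec_nat (e 0) (\<lambda>_ r. r - 1) (e 1))"
    by (intro rc_rec_nat rc_var rc_pred) auto
  ultimately show "rc 2 (\<lambda>e. e 0 - e 1)" by simp
qed

lemma rc_mult:
  assumes "rc n a" "rc n b" shows "rc n (\<lambda>e. a e * b e)"
proof (rule rc_comp2[of "(*)", OF _ assms])
  have "rec_nat 0 (\<lambda>_ r. r + x) y = x * y" for x y by (induction y) auto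
  moreover have "rc 2 (\<lambda>e. rec_nat 0 (\<lambda>_ r. r + e 0) (e 1))"
    by (intro rc_rec_nat rc_var rc_add rc_const) auto
  ultimately show "rc 2 (\<lambda>e. e 0 * e 1)" by simp
qed

lemma rc_power:
  assumes "rc n a" "rc n b" shows "rc n (\<lambda>e. a e ^ b e)"
proof (rule rc_comp2[of "(^)", OF _ assms])
  have "rec_nat 1 (\<lambda>_ r. r * x) y = x ^ y" for x y :: nat by (induction y) auto
  moreover have "rc 2 (\<lambda>e. rec_nat 1 (\<lambda>_ r. r * e 0) (e 1))"
    by (intro rc_rec_nat rc_var rc_mult rc_const) auto
  ultimately show "rc 2 (\<lambda>e. e 0 ^ e 1)" by simp
qed

lemma rc_sum:
  assumes "rc n m" "rc (Suc n) (\<lambda>e. f (e 0) (\<lambda>i. e (Suc i)))"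
  shows "rc n (\<lambda>e. \<Sum>i<m e. f i e)"
proof -
  have eq: "(\<Sum>i<m. f i e) = rec_nat 0 (\<lambda>k r. r + f k e) m" for m e by (induction m) auto
  have "rc (Suc (Suc n)) (\<lambda>e. f (e 0) (\<lambda>i. e (Suc (Suc i))))"
  proof -
    \<comment> \<open>The body of a sum binds only the index, whereas the recursion step also binds
      the accumulator as argument 1. This substitution skips the accumulator.\<close>
    let ?as = "(\<lambda>e. e 0) # map (\<lambda>i e. e (Suc (Suc i))) [0..<n]"
    have "rc (Suc (Suc n)) (\<lambda>e. (\<lambda>e. f (e 0) (\<lambda>i. e (Suc i))) (\<lambda>i. (?as ! i) e))"
      by (rule rc_comp) (use assms in \<open>auto intro: rc_var\<close>)
    moreover have "(\<lambda>e. f (e 0) (\<lambda>i. e (Suc i))) (\<lambda>i. (?as ! i) e) =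
        (\<lambda>e. f (e 0) (\<lambda>i. e (Suc i))) (case_nat (e 0) (\<lambda>i. e (Suc (Suc i))))" for e
      by (rule rc_cong_env[OF assms(2)]) (auto split: nat.split simp: nth_Cons)
    ultimately show ?thesis by simp
  qed
  then show ?thesis unfolding eq
    by (intro rc_rec_nat assms rc_const rc_add rc_var) auto
qed

lemma rcp_not: "rcp n P \<Longrightarrow> rcp n (\<lambda>e. \<not> P e)"
proof -
  have "of_bool (\<not> Q) = 1 - (of_bool Q :: nat)" for Q by simp
  then show "rcp n P \<Longrightarrow> ?thesis"
    unfolding rcp_def by (simp only:) (intro rc_diff rc_const)
qed

lemma rcp_conj: "rcp n P \<Longrightarrow> rcp n Q \<Longrightarrow> rcp n (\<lambda>e. P e \<and> Q e)"
  unfolding rcp_def of_bool_conj by (intro rc_mult)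

lemma rcp_disj: "rcp n P \<Longrightarrow> rcp n Q \<Longrightarrow> rcp n (\<lambda>e. P e \<or> Q e)"
  using rcp_not[OF rcp_conj[OF rcp_not rcp_not, of n P Q]] by simp

lemma rcp_imp: "rcp n P \<Longrightarrow> rcp n Q \<Longrightarrow> rcp n (\<lambda>e. P e \<longrightarrow> Q e)"
  unfolding imp_conv_disj by (intro rcp_disj rcp_not)

lemma rcp_iff: "rcp n P \<Longrightarrow> rcp n Q \<Longrightarrow> rcp n (\<lambda>e. P e = Q e)"
  unfolding iff_conv_conj_imp by (intro rcp_conj rcp_imp)

lemma rcp_le: "rc n a \<Longrightarrow> rc n b \<Longrightarrow> rcp n (\<lambda>e. a e \<le> b e)"
proof -
  have "of_bool (x \<le> y) = 1 - (x - y)" for x y :: nat by auto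
  then show "rc n a \<Longrightarrow> rc n b \<Longrightarrow> rcp n (\<lambda>e. a e \<le> b e)"
    unfolding rcp_def by (simp only:) (intro rc_diff rc_const)
qed

lemma rcp_less: "rc n a \<Longrightarrow> rc n b \<Longrightarrow> rcp n (\<lambda>e. a e < b e)"
  unfolding less_eq_Suc_le by (intro rcp_le rc_Suc)

lemma rcp_eq: "rc n a \<Longrightarrow> rc n b \<Longrightarrow> rcp n (\<lambda>e. a e = b e)"
  unfolding order_eq_iff by (intro rcp_conj rcp_le)

lemma rc_of_bool: "rcp n P \<Longrightarrow> rc n (\<lambda>e. of_bool (P e))"
  by (simp add: rcp_def)

lemma rc_if: "rcp n P \<Longrightarrow> rc n a \<Longrightarrow> rc n b \<Longrightarrow> rc n (\<lambda>e. if P e then a e else b e)"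
proof -
  have "(if P then x else y) = of_bool P * x + (1 - of_bool P) * y" for P and x y :: nat by auto
  then show "rcp n P \<Longrightarrow> rc n a \<Longrightarrow> rc n b \<Longrightarrow> ?thesis"
    by (simp only:) (intro rc_add rc_mult rc_diff rc_const rc_of_bool)
qed

lemma rcp_all:
  assumes "rc n m" "rcp (Suc n) (\<lambda>e. P (e 0) (\<lambda>i. e (Suc i)))"
  shows "rcp n (\<lambda>e. \<forall>i<m e. P i e)"
proof -
  have "(\<forall>i<m e. P i e) \<longleftrightarrow> (\<Sum>i<m e. of_bool (\<not> P i e)) = (0::nat)" for e by auto
  then show ?thesis
    using assms by (simp only:) (intro rcp_eq rc_sum rc_const rc_of_bool rcp_not)
qed

lemma rcp_ex:
  assumes "rc n m" "rcp (Suc n) (\<lambda>e. P (e 0) (\<lambda>i. e (Suc i)))"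
  shows "rcp n (\<lambda>e. \<exists>i<m e. P i e)"
proof -
  have "(\<exists>i<m e. P i e) \<longleftrightarrow> \<not> (\<forall>i<m e. \<not> P i e)" for e by auto
  then show ?thesis
    using assms by (simp only:) (intro rcp_not rcp_all)
qed

text \<open>\<open>minimise\<close> searches for a zero, hence the negated characteristic function.
  Existence is assumed for every environment because \<open>total_recursive\<close> admits only
  searches that end on all arguments.\<close>

lemma rc_Least:
  assumes "rcp (Suc n) (\<lambda>e. P (e 0) (\<lambda>i. e (Suc i)))" "\<And>e. \<exists>k. P k e"
  shows "rc n (\<lambda>e. LEAST k. P k e)"
proof -
  have "rc (Suc n) (\<lambda>e. of_bool (\<not> P (e 0) (\<lambda>i. e (Suc i))))"
    using assms(1) by (intro rc_of_bool rcp_not)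
  then obtain g where g: "total_recursive (Suc n) g"
    "\<And>e. of_bool (\<not> P (e 0) (\<lambda>i. e (Suc i))) = g (map e [0..<Suc n])"
    unfolding rc_def by blast
  have g': "g (k # map e [0..<n]) = 0 \<longleftrightarrow> P k e" for k e
    using g(2)[of "case_nat k e", symmetric] by (simp add: map_upt_shift del: upt_Suc)
  show ?thesis
  proof (rule rcI[OF total_recursive.minimise[OF g(1)]])
    show "\<forall>xs. length xs = n \<longrightarrow> (\<exists>k. g (k # xs) = 0)"
    proof (intro allI impI)
      fix xs :: "nat list" assume "length xs = n"
      then have "map (\<lambda>i. xs ! i) [0..<n] = xs" by (auto simp: list_eq_iff_nth_eq)
      then show "\<exists>k. g (k # xs) = 0" using assms(2) g' by metis
    qed
  qed (simp add: g')
qed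

lemmas rc_intros = rc_const rc_var rc_Suc rc_add rc_diff rc_mult rc_power rc_sum rc_of_bool rc_if
  rcp_not rcp_conj rcp_disj rcp_imp rcp_iff rcp_le rcp_less rcp_eq rcp_all rcp_ex

lemma rc_div:
  assumes "rc n a" "rc n b" shows "rc n (\<lambda>e. a e div b e)"
proof (rule rc_comp2[of "(div)", OF _ assms])
  \<comment> \<open>The quotient counts the positive multiples of \<open>y\<close> up to
    \<open>x\<close>; the guard gives the value 0 for division by zero.\<close>
  have "x div y = (\<Sum>i<x. of_bool (0 < y \<and> Suc i * y \<le> x))" for x y :: nat
  proof (cases "y = 0")
    case False
    then have "{i. i < x \<and> Suc i * y \<le> x} = {..<x div y}"
      by (auto simp: less_eq_div_iff_mult_less_eq Suc_le_eq[symmetric] simp del: mult_Suc)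
         (meson False Suc_leD div_le_dividend le_trans less_eq_div_iff_mult_less_eq not_gr_zero)+
    then have "{..<x} \<inter> {i. Suc i * y \<le> x} = {..<x div y}" by auto
    then show ?thesis using False by (simp del: mult_Suc)
  qed simp
  moreover have "rc 2 (\<lambda>e. \<Sum>i<e 0. of_bool (0 < e 1 \<and> Suc i * e 1 \<le> e 0))"
    by (intro rc_intros) auto
  ultimately show "rc 2 (\<lambda>e. e 0 div e 1)" by simp
qed

lemma rc_mod:
  assumes "rc n a" "rc n b" shows "rc n (\<lambda>e. a e mod b e)"
  unfolding modulo_nat_def by (intro rc_intros rc_div assms)

lemma rc_prod_encode:
  assumes "rc n a" "rc n b" shows "rc n (\<lambda>e. prod_encode (a e, b e))"
proof (rule rc_comp2[of "\<lambda>x y. prod_encode (x, y)", OF _ assms])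
  have "triangle m = (\<Sum>i<m. Suc i)" for m by (induction m) auto
  then have "prod_encode (x, y) = (\<Sum>i<x + y. Suc i) + x" for x y by (simp add: prod_encode_def)
  moreover have "rc 2 (\<lambda>e. (\<Sum>i<e 0 + e 1. Suc i) + e 0)"
    by (intro rc_intros) auto
  ultimately show "rc 2 (\<lambda>e. prod_encode (e 0, e 1))" by simp
qed

text \<open>Decoding by search: the components of a pair do not exceed its code, so the other
  component ranges over a bounded set.\<close>

lemma rc_fst_prod_decode:
  assumes "rc n a" shows "rc n (\<lambda>e. fst (prod_decode (a e)))"
proof (rule rc_comp1[of "\<lambda>z. fst (prod_decode z)", OF _ assms])
  have "fst (prod_decode z) = (LEAST x. \<exists>y<Suc z. prod_encode (x, y) = z)" for z
  proof -
    have "(\<exists>y<Suc z. prod_encode (x, y) = z) \<longleftrightarrow> x = fst (prod_decode z)" for x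
    proof
      assume "x = fst (prod_decode z)"
      then have "prod_encode (x, snd (prod_decode z)) = z" by simp
      then show "\<exists>y<Suc z. prod_encode (x, y) = z"
        using le_prod_encode_2[of "snd (prod_decode z)" x] by (metis less_Suc_eq_le)
    qed auto
    then show ?thesis by (simp add: Least_equality)
  qed
  moreover have "rc 1 (\<lambda>e. LEAST x. \<exists>y<Suc (e 0). prod_encode (x, y) = e 0)"
  proof (intro rc_Least rc_intros rc_prod_encode)
    show "\<exists>x. \<exists>y<Suc (e 0). prod_encode (x, y) = e 0" for e :: "nat \<Rightarrow> nat"
      using le_prod_encode_2[of "snd (prod_decode (e 0))" "fst (prod_decode (e 0))"]
      by (intro exI[of _ "fst (prod_decode (e 0))"] exI[of _ "snd (prod_decode (e 0))"]) simp
  qed auto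
  ultimately show "rc 1 (\<lambda>e. fst (prod_decode (e 0)))" by simp
qed

lemma rc_snd_prod_decode:
  assumes "rc n a" shows "rc n (\<lambda>e. snd (prod_decode (a e)))"
proof (rule rc_comp1[of "\<lambda>z. snd (prod_decode z)", OF _ assms])
  have "snd (prod_decode z) = (LEAST y. \<exists>x<Suc z. prod_encode (x, y) = z)" for z
  proof -
    have "(\<exists>x<Suc z. prod_encode (x, y) = z) \<longleftrightarrow> y = snd (prod_decode z)" for y
    proof
      assume "y = snd (prod_decode z)"
      then have "prod_encode (fst (prod_decode z), y) = z" by simp
      then show "\<exists>x<Suc z. prod_encode (x, y) = z"
        using le_prod_encode_1[of "fst (prod_decode z)" y] by (metis less_Suc_eq_le)
    qed auto
    then show ?thesis by (simp add: Least_equality)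
  qed
  moreover have "rc 1 (\<lambda>e. LEAST y. \<exists>x<Suc (e 0). prod_encode (x, y) = e 0)"
  proof (intro rc_Least rc_intros rc_prod_encode)
    show "\<exists>y. \<exists>x<Suc (e 0). prod_encode (x, y) = e 0" for e :: "nat \<Rightarrow> nat"
      using le_prod_encode_1[of "fst (prod_decode (e 0))" "snd (prod_decode (e 0))"]
      by (intro exI[of _ "fst (prod_decode (e 0))"] exI[of _ "snd (prod_decode (e 0))"]) simp
  qed auto
  ultimately show "rc 1 (\<lambda>e. snd (prod_decode (e 0)))" by simp
qed


section \<open>Computability of the exploration sequence and of the label code\<close>

lemma rc_digit:
  assumes "rc n a" "rc n b" "rc n c" shows "rc n (\<lambda>e. digit (a e) (b e) (c e))"
  unfolding digit_def by (intro rc_intros rc_div rc_mod assms)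

lemma rc_exploration_length:
  assumes "rc n a" shows "rc n (\<lambda>e. exploration_length (a e))"
  unfolding exploration_length_def by (intro rc_intros assms)

lemma rc_table_step:
  assumes "rc n a" "rc n b" "rc n c" "rc n d" shows "rc n (\<lambda>e. table_step (a e) (b e) (c e) (d e))"
  unfolding table_step_def by (intro rc_intros rc_digit assms)

lemma walk_rec_nat: "walk \<sigma> x s j = rec_nat s (\<lambda>i r. \<sigma> r (x i)) j"
  by (induction j) auto

text \<open>All quantifiers involved are bounded by computable terms; cardinalities become sums, and
  walks become primitive recursions.\<close>

lemma rcp_universal:
  assumes "rc n a" "rc n b" shows "rcp n (\<lambda>e. universal (a e) (b e))"
  unfolding rcp_def
proof (rule rc_comp2[of "\<lambda>x y. of_bool (universal x y)", OF _ assms])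
  have card_eq: "card {p. p < M \<and> Q p} = (\<Sum>p<M. of_bool (Q p))" for M :: nat and Q
    by (simp add: Int_def)
  show "rc 2 (\<lambda>e. of_bool (universal (e 0) (e 1)))"
    unfolding universal_def symmetric_table_def card_eq walk_rec_nat
    by (intro rc_intros rc_rec_nat rc_table_step rc_digit rc_exploration_length) auto
qed

lemma rc_exploration:
  assumes "rc n a" "rc n b" shows "rc n (\<lambda>e. exploration (a e) (b e))"
  unfolding exploration_def
proof (intro rc_digit assms)
  show "rc n (\<lambda>e. LEAST k. universal (a e) k)"
    by (rule rc_comp1[of "\<lambda>x. LEAST k. universal x k", OF _ assms(1)])
       (intro rc_Least rcp_universal rc_var exists_universal; simp)
qed

text \<open>The length of the binary representation, with value 0 at 0, in a form that minimisation
  computes.\<close>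

definition bit_length :: "nat \<Rightarrow> nat" where
  "bit_length l = (LEAST m. l < 2 ^ m)"

lemma exists_power_greater: "\<exists>m. (l::nat) < 2 ^ m"
  using less_exp by blast

lemma rc_bit_length:
  assumes "rc n a" shows "rc n (\<lambda>e. bit_length (a e))"
  unfolding bit_length_def
  by (rule rc_comp1[of "\<lambda>x. LEAST m. x < 2 ^ m", OF _ assms])
     (intro rc_Least rc_intros exists_power_greater; simp)

text \<open>
  Bit 0 makes everybody tour on waking up; then comes the bit length in unary, and then the bits of
  the label. The leader is therefore among the agents with the shortest labels.
\<close>

definition label_code :: "nat \<Rightarrow> nat \<Rightarrow> bool" where
  "label_code l j \<longleftrightarrow> j = 0 \<or> j = bit_length l \<or>
     (bit_length l < j \<and> l div 2 ^ (j - Suc (bit_length l)) mod 2 = 1)"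

lemma rcp_label_code:
  assumes "rc n a" "rc n b" shows "rcp n (\<lambda>e. label_code (a e) (b e))"
  unfolding label_code_def by (intro rc_intros rc_bit_length rc_div rc_mod assms)

text \<open>The code of a nonempty list is the successor of a pair of head and coded tail. On 0, the
  code of the empty list, truncated subtraction makes the result 0 again.\<close>

definition history_tail :: "nat \<Rightarrow> nat" where
  "history_tail H = snd (prod_decode (H - 1))"

definition history_drop :: "nat \<Rightarrow> nat \<Rightarrow> nat" where
  "history_drop i H = (history_tail ^^ i) H"

definition history_length :: "nat \<Rightarrow> nat" where
  "history_length H = (LEAST i. history_drop i H = 0)"

definition history_nth :: "nat \<Rightarrow> nat \<Rightarrow> nat" where
  "history_nth H i = fst (prod_decode (history_drop i H - 1))"

lemma history_drop_encode: "history_drop i (list_encode xs) = list_encode (drop i xs)"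
proof (induction i)
  case (Suc i)
  have "history_tail (list_encode ys) = list_encode (tl ys)" for ys
  proof (cases ys)
    case Nil
    then show ?thesis
      using prod_encode_inverse[of "(0, 0)"] by (simp add: history_tail_def prod_encode_def)
  qed (simp add: history_tail_def)
  then show ?case using Suc by (simp add: history_drop_def drop_Suc tl_drop)
qed (simp add: history_drop_def)

lemma list_encode_eq_0_iff: "list_encode xs = 0 \<longleftrightarrow> xs = []"
  by (cases xs) auto

lemma history_length_encode [simp]: "history_length (list_encode xs) = length xs"
  unfolding history_length_def history_drop_encode list_encode_eq_0_iff
  by (rule Least_equality) auto

lemma history_nth_encode: "i < length xs \<Longrightarrow> history_nth (list_encode xs) i = xs ! i"
  unfolding history_nth_def history_drop_encode
  by (simp add: Cons_nth_drop_Suc[symmetric])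

lemma rc_history_drop:
  assumes "rc n a" "rc n b" shows "rc n (\<lambda>e. history_drop (a e) (b e))"
proof -
  have "history_drop i H = rec_nat H (\<lambda>_ r. history_tail r) i" for i H
    by (induction i) (auto simp: history_drop_def)
  then show ?thesis
    by (simp only: history_tail_def) (intro rc_rec_nat assms rc_snd_prod_decode rc_intros; simp)
qed

lemma rc_history_nth:
  assumes "rc n a" "rc n b" shows "rc n (\<lambda>e. history_nth (a e) (b e))"
  unfolding history_nth_def by (intro rc_fst_prod_decode rc_history_drop rc_intros assms)

lemma rc_history_length:
  assumes "rc n a" shows "rc n (\<lambda>e. history_length (a e))"
  unfolding history_length_def
proof (rule rc_comp1[of "\<lambda>H. LEAST i. history_drop i H = 0", OF _ assms])
  \<comment> \<open>Every number codes a list, so this search ends on arbitrary arguments.\<close>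
  have "\<exists>k. history_drop k H = 0" for H
    using history_drop_encode[of "length (list_decode H)" "list_decode H"] by auto
  then show "rc 1 (\<lambda>e. LEAST i. history_drop i (e 0) = 0)"
    by (intro rc_Least rc_intros rc_history_drop; simp)
qed

text \<open>The port of entry is shifted by one, and 0 if there is none. Index 0 is the current round.\<close>

definition entry_ago :: "nat \<Rightarrow> nat \<Rightarrow> nat" where
  "entry_ago H i = fst (prod_decode (snd (prod_decode (history_nth H i))))"

definition count_ago :: "nat \<Rightarrow> nat \<Rightarrow> nat" where
  "count_ago H i = snd (prod_decode (snd (prod_decode (history_nth H i))))"

lemma rc_entry_ago:
  assumes "rc n a" "rc n b" shows "rc n (\<lambda>e. entry_ago (a e) (b e))"
  unfolding entry_ago_def by (intro rc_fst_prod_decode rc_snd_prod_decode rc_history_nth assms)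

lemma rc_count_ago:
  assumes "rc n a" "rc n b" shows "rc n (\<lambda>e. count_ago (a e) (b e))"
  unfolding count_ago_def by (intro rc_snd_prod_decode rc_history_nth assms)

text \<open>
  An agent counts rounds starting from \<open>exploration_length N\<close> at its wake-up, so that its first
  tour, like all the others, occupies the two middle quarters of a slot.
\<close>

definition clock :: "nat \<Rightarrow> nat \<Rightarrow> nat" where
  "clock N H = history_length H - 1 + exploration_length N"

text \<open>The bit heard in slot \<open>j\<close>. A nonzero port of entry records a move of the
  agent itself, so that a touring agent hears its own bit. The clock shows
  \<open>exploration_length N\<close> at wake-up; the lower bound hence skips the part of slot 0
  before it.\<close>

definition noise :: "nat \<Rightarrow> nat \<Rightarrow> nat \<Rightarrow> bool" where
  "noise N H j \<longleftrightarrow> (\<exists>t<4 * exploration_length N.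
     exploration_length N \<le> 4 * exploration_length N * j + t \<and>
     (entry_ago H (clock N H - (4 * exploration_length N * j + t)) \<noteq> 0 \<or>
      2 \<le> count_ago H (clock N H - (4 * exploration_length N * j + t))))"

definition elected :: "nat \<Rightarrow> nat \<Rightarrow> nat \<Rightarrow> nat \<Rightarrow> bool" where
  "elected N H s L \<longleftrightarrow> 0 < L \<and> 2 * bit_length L < s \<and>
     (\<forall>j<Suc (2 * bit_length L). noise N H j \<longleftrightarrow> label_code L j)"

text \<open>The alternative \<open>2 ^ s \<le> L\<close> ends the search: if no smaller label is
  elected, the value is \<open>2 ^ s\<close>. A label whose code fits into \<open>s\<close> slots is
  smaller, so the comparison with \<open>2 ^ s\<close> tells whether the election is over.\<close>

definition leader :: "nat \<Rightarrow> nat \<Rightarrow> nat \<Rightarrow> nat" where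
  "leader N H s = (LEAST L. elected N H s L \<or> 2 ^ s \<le> L)"

text \<open>In the third quarter the moves are undone in reverse order. At offset \<open>i\<close>
  of that quarter the relevant entry lies \<open>2 * i\<close> rounds back. Entry 0 marks an outward
  step that was a self-loop, with nothing to undo; subtracting 1 reverts the shift of ports.\<close>

definition tour_action :: "nat \<Rightarrow> nat \<Rightarrow> nat \<Rightarrow> action" where
  "tour_action N H \<rho> =
     (if \<rho> < exploration_length N then Stay
      else if \<rho> < 2 * exploration_length N then Move (exploration N (\<rho> - exploration_length N))
      else if \<rho> < 3 * exploration_length N \<and> entry_ago H (2 * (\<rho> - 2 * exploration_length N)) \<noteq> 0
      then Move (entry_ago H (2 * (\<rho> - 2 * exploration_length N)) - 1)
      else Stay)"

definition election_action :: "nat \<Rightarrow> nat \<Rightarrow> nat \<Rightarrow> nat \<Rightarrow> nat \<Rightarrow> action" where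
  "election_action N l H s \<rho> =
     (if label_code l s \<and> (\<forall>i<s. noise N H i \<longleftrightarrow> label_code l i) then tour_action N H \<rho> else Stay)"

text \<open>Here \<open>k\<close> is the number of completed assembly slots. Noise in one of them
  means that the leader has come by, so from then on the agent makes the same single move per slot.
  After \<open>exploration_length N\<close> steps every node has been visited.\<close>

definition assembly_action :: "nat \<Rightarrow> nat \<Rightarrow> nat \<Rightarrow> nat \<Rightarrow> nat \<Rightarrow> nat \<Rightarrow> action" where
  "assembly_action N l H L k \<rho> =
     (if exploration_length N \<le> k then Declare L
      else if \<rho> = exploration_length N \<and> (l = L \<or> (\<exists>j<k. noise N H (Suc (2 * bit_length L) + j)))
      then Move (exploration N k)
      else Stay)"

definition gather_action :: "nat \<Rightarrow> nat \<Rightarrow> nat \<Rightarrow> nat \<Rightarrow> nat \<Rightarrow> action" where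
  "gather_action N l H s \<rho> =
     (if leader N H s < 2 ^ s
      then assembly_action N l H (leader N H s) (s - Suc (2 * bit_length (leader N H s))) \<rho>
      else election_action N l H s \<rho>)"

definition gather :: algorithm where
  "gather N l h =
     (let H = list_encode (map encode_observation h)
      in gather_action N l H (clock N H div (4 * exploration_length N)) (clock N H mod (4 * exploration_length N)))"

section \<open>Computability of the individual decisions and of the whole algorithm\<close>

lemma rc_clock:
  assumes "rc n a" "rc n b" shows "rc n (\<lambda>e. clock (a e) (b e))"
  unfolding clock_def by (intro rc_intros rc_history_length rc_exploration_length assms)

lemma rcp_noise:
  assumes "rc n a" "rc n b" "rc n c" shows "rcp n (\<lambda>e. noise (a e) (b e) (c e))"
  unfolding rcp_def
  by (rule rc_comp3[of "\<lambda>x y z. of_bool (noise x y z)", OF _ assms], unfold noise_def)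
     (intro rc_intros rc_entry_ago rc_count_ago rc_clock rc_exploration_length; simp)

lemma rcp_elected:
  assumes "rc n a" "rc n b" "rc n c" "rc n d"
  shows "rcp n (\<lambda>e. elected (a e) (b e) (c e) (d e))"
  unfolding rcp_def
  by (rule rc_comp4[of "\<lambda>x y z w. of_bool (elected x y z w)", OF _ assms], unfold elected_def)
     (intro rc_intros rcp_noise rcp_label_code rc_bit_length; simp)

lemma rc_leader:
  assumes "rc n a" "rc n b" "rc n c" shows "rc n (\<lambda>e. leader (a e) (b e) (c e))"
  unfolding leader_def
  by (rule rc_comp3[of "\<lambda>x y z. LEAST L. elected x y z L \<or> 2 ^ z \<le> L", OF _ assms])
     (intro rc_Least rc_intros rcp_elected; auto)

definition rca :: "nat \<Rightarrow> ((nat \<Rightarrow> nat) \<Rightarrow> action) \<Rightarrow> bool" where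
  "rca n f \<longleftrightarrow> rc n (\<lambda>e. encode_action (f e))"

lemma rca_Stay: "rca n (\<lambda>e. Stay)"
  unfolding rca_def by (rule rc_const)

lemma rca_Move: "rc n a \<Longrightarrow> rca n (\<lambda>e. Move (a e))"
  unfolding rca_def encode_action.simps by (intro rc_prod_encode rc_const)

lemma rca_Declare: "rc n a \<Longrightarrow> rca n (\<lambda>e. Declare (a e))"
  unfolding rca_def encode_action.simps by (intro rc_prod_encode rc_const)

lemma rca_if: "rcp n P \<Longrightarrow> rca n f \<Longrightarrow> rca n g \<Longrightarrow> rca n (\<lambda>e. if P e then f e else g e)"
  unfolding rca_def if_distrib[of encode_action] by (rule rc_if)

lemma computable_gather: "computable gather"
proof -
  have "rca 3 (\<lambda>e. gather_action (e 0) (e 1) (e 2)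
      (clock (e 0) (e 2) div (4 * exploration_length (e 0)))
      (clock (e 0) (e 2) mod (4 * exploration_length (e 0))))" (is "rca 3 ?f")
    unfolding gather_action_def election_action_def assembly_action_def tour_action_def
    by (intro rca_if rca_Stay rca_Move rca_Declare rc_intros rcp_noise rcp_label_code rc_bit_length
        rc_leader rc_clock rc_exploration rc_exploration_length rc_entry_ago rc_div rc_mod; simp)
  then obtain g where g: "total_recursive 3 g" "\<And>e. encode_action (?f e) = g (map e [0..<3])"
    unfolding rca_def rc_def by blast
  have "g [N, l, H] = encode_action (gather_action N l H
      (clock N H div (4 * exploration_length N)) (clock N H mod (4 * exploration_length N)))" for N l H
    using g(2)[of "\<lambda>i. [N, l, H] ! i"] by (simp add: upt_rec[of _ 3] eval_nat_numeral)
  then show ?thesis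
    unfolding computable_def gather_def Let_def using g(1) by auto
qed

section \<open>Labels as prefix-free codes, and the wake-up phase\<close>

lemma less_bit_length: "l < 2 ^ bit_length l"
  unfolding bit_length_def by (rule LeastI_ex) (rule exists_power_greater)

lemma bit_length_pos: "0 < l \<Longrightarrow> 0 < bit_length l"
  using less_bit_length[of l] by (cases "bit_length l") auto

lemma bit_length_mono: "l \<le> l' \<Longrightarrow> bit_length l \<le> bit_length l'"
  unfolding bit_length_def[of l] using less_bit_length[of l'] by (intro Least_le) simp

lemma bit_length_le_floorlog: "bit_length l \<le> floorlog 2 l"
proof (cases "l = 0")
  case True
  then show ?thesis by (simp add: bit_length_def)
next
  case False
  then have "l < 2 ^ floorlog 2 l" using floorlog_bounds[of l 2] by simp
  then show ?thesis unfolding bit_length_def by (rule Least_le)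
qed

lemma eq_if_same_bits:
  assumes "l < 2 ^ m" "l' < 2 ^ m" "\<And>b. b < m \<Longrightarrow> l div 2 ^ b mod 2 = l' div 2 ^ b mod (2::nat)"
  shows "l = l'"
  using assms
proof (induction m arbitrary: l l')
  case (Suc m)
  have "l div 2 = l' div 2"
  proof (rule Suc.IH)
    show "l div 2 < 2 ^ m" "l' div 2 < 2 ^ m" using Suc.prems by auto
    show "l div 2 div 2 ^ b mod 2 = l' div 2 div 2 ^ b mod 2" if "b < m" for b
      using Suc.prems(3)[of "Suc b"] that by (simp add: div_mult2_eq)
  qed
  moreover have "l mod 2 = l' mod 2" using Suc.prems(3)[of 0] by simp
  ultimately show ?case by (metis mult_div_mod_eq)
qed simp

lemma label_code_first:
  assumes "0 < j" "j < bit_length l"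
  shows "\<not> label_code l j"
  using assms by (simp add: label_code_def)

text \<open>The first set bit after position 0 marks the bit length. Equal prefixes thus force equal
  lengths, and the remaining positions list the binary digits.\<close>

lemma label_code_prefix_free:
  assumes "0 < l" "0 < l'" and eq: "\<And>j. j \<le> 2 * bit_length l' \<Longrightarrow> label_code l j = label_code l' j"
  shows "l = l'"
proof -
  have pos: "0 < bit_length l" "0 < bit_length l'" using assms(1,2) bit_length_pos by auto
  have self: "label_code l (bit_length l)" "label_code l' (bit_length l')"
    by (simp_all add: label_code_def)
  have bl: "bit_length l = bit_length l'"
    using eq[of "bit_length l"] eq[of "bit_length l'"] self pos
      label_code_first[of "bit_length l" l'] label_code_first[of "bit_length l'" l]
    by (cases "bit_length l" "bit_length l'" rule: linorder_cases) auto
  show ?thesis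
  proof (rule eq_if_same_bits)
    show "l < 2 ^ bit_length l'" "l' < 2 ^ bit_length l'" using less_bit_length bl by metis+
    fix b assume "b < bit_length l'"
    then show "l div 2 ^ b mod 2 = l' div 2 ^ b mod 2"
      using eq[of "Suc (bit_length l' + b)"] bl by (auto simp: label_code_def)
  qed
qed

section \<open>The election as a process on a set of labels\<close>

primrec alive :: "nat set \<Rightarrow> nat \<Rightarrow> nat set" where
  "alive T 0 = T"
| "alive T (Suc i) = {l \<in> alive T i. label_code l i \<longleftrightarrow> (\<exists>l'\<in>alive T i. label_code l' i)}"

text \<open>The bit that slot \<open>i\<close> broadcasts, as shown later for the actual
  execution.\<close>

definition contested :: "nat set \<Rightarrow> nat \<Rightarrow> bool" where
  "contested T i \<longleftrightarrow> (\<exists>l\<in>alive T i. label_code l i)"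

lemma alive_eq: "alive T i = {l \<in> T. \<forall>j<i. contested T j \<longleftrightarrow> label_code l j}"
  by (induction i) (auto simp: contested_def less_Suc_eq)

lemma alive_nonempty: "T \<noteq> {} \<Longrightarrow> alive T i \<noteq> {}"
  by (induction i) auto

lemma contested_0: "T \<noteq> {} \<Longrightarrow> contested T 0"
  by (auto simp: contested_def label_code_def)

text \<open>The set of survivors never becomes empty, so some label survives through the length of
  the longest code. Its own code has then been compared completely.\<close>

lemma exists_winner:
  assumes "finite T" "T \<noteq> {}"
  shows "\<exists>L\<in>T. \<forall>j\<le>2 * bit_length L. contested T j \<longleftrightarrow> label_code L j"
proof -
  obtain L where L: "L \<in> alive T (Suc (2 * bit_length (Max T)))"
    using alive_nonempty[OF assms(2)] by blast
  then have "L \<in> T" by (simp add: alive_eq)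
  with assms have "bit_length L \<le> bit_length (Max T)" by (intro bit_length_mono) auto
  with L \<open>L \<in> T\<close> show ?thesis by (intro bexI[of _ L]) (auto simp: alive_eq)
qed

text \<open>If the code of \<open>L\<close> were longer, its unary part would make slots 1 to
  \<open>bit_length a\<close> silent. Then \<open>a\<close> would survive until slot
  \<open>bit_length a\<close> and set the bit there, a contradiction.\<close>

lemma winner_bit_length:
  assumes "a \<in> T" "0 < a" and L: "\<forall>j\<le>2 * bit_length L. contested T j \<longleftrightarrow> label_code L j"
  shows "bit_length L \<le> bit_length a"
proof (rule ccontr)
  assume less: "\<not> ?thesis"
  have *: "\<not> contested T j" if "0 < j" "j \<le> bit_length a" for j
    using L that less label_code_first[of j L] by auto
  have "T \<noteq> {}" using assms by blast
  have "contested T j \<longleftrightarrow> label_code a j" if "j < bit_length a" for j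
    using *[of j] that contested_0[OF \<open>T \<noteq> {}\<close>] label_code_first[of j a]
    by (cases "j = 0") (auto simp: label_code_def)
  then have "a \<in> alive T (bit_length a)" using assms by (simp add: alive_eq)
  then have "contested T (bit_length a)" by (auto simp: contested_def label_code_def)
  with *[of "bit_length a"] bit_length_pos[OF assms(2)] show False by blast
qed

section \<open>Executions in a fixed scenario, up to the wake-up of all agents\<close>

locale gathering =
  fixes N :: nat and X :: scenario
  assumes N: "2 \<le> N" and valid_X: "valid_scenario X" and size: "card (nodes (net X)) \<le> N"
begin

sublocale valid_net "net X"
  using valid_X by unfold_locales (simp add: valid_scenario_def)

definition B :: nat where "B = exploration_length N"

definition conf :: "nat \<Rightarrow> configuration" where "conf = run gather N X"

definition pos :: "nat \<Rightarrow> nat \<Rightarrow> nat" where "pos a r = loc (conf r a)"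

definition seen :: "nat \<Rightarrow> nat \<Rightarrow> status" where "seen a r = perceive X r (conf r) a"

definition path :: "nat \<Rightarrow> nat \<Rightarrow> nat" where "path = walk (move (net X)) (exploration N)"

definition crowd :: "nat \<Rightarrow> nat \<Rightarrow> nat" where
  "crowd a r = card {b \<in> team X. pos b r = pos a r}"

definition obs :: "nat \<Rightarrow> nat \<Rightarrow> observation" where
  "obs a r = (degree_at (net X) (pos a r), entry (conf r a), crowd a r)"

definition woken :: "nat \<Rightarrow> nat" where "woken a = (LEAST r. seen a r \<noteq> Dormant)"

definition history :: "nat \<Rightarrow> nat \<Rightarrow> observation list" where
  "history a r = map (obs a) (rev [woken a..<Suc r])"

definition code :: "nat \<Rightarrow> nat \<Rightarrow> nat" where
  "code a r = list_encode (map encode_observation (history a r))"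

abbreviation act :: "nat \<Rightarrow> nat \<Rightarrow> action" where
  "act a r \<equiv> chosen_action gather N a (seen a r)"

lemma B_pos: "0 < B"
  using N by (simp add: B_def exploration_length_def)

lemma finite_team: "finite (team X)" and start_inj: "inj_on (start X) (team X)"
  and start_in_nodes: "a \<in> team X \<Longrightarrow> start X a \<in> nodes (net X)" and label_pos: "a \<in> team X \<Longrightarrow> 0 < a"
  and team_card: "2 \<le> card (team X)"
  using valid_X by (auto simp: valid_scenario_def)

lemma conf_Suc: "conf (Suc r) a = perform (net X) (pos a r) (seen a r) (act a r)"
  by (simp add: conf_def pos_def seen_def Let_def)

lemma status_Suc: "status (conf (Suc r) a) = (case act a r of Declare _ \<Rightarrow> Terminated | _ \<Rightarrow> seen a r)"
  unfolding conf_Suc by (cases "act a r") (auto simp: Let_def)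

lemma pos_Suc: "pos a (Suc r) = (case act a r of Move p \<Rightarrow> move (net X) (pos a r) p | _ \<Rightarrow> pos a r)"
  by (cases "act a r") (auto simp: pos_def[of a "Suc r"] conf_Suc Let_def move_def)

lemma entry_Suc: "entry (conf (Suc r) a) = (case act a r of
    Move p \<Rightarrow> if p < degree_at (net X) (pos a r)
      then Some (port (net X) (pos a (Suc r)) (pos a r)) else None
  | _ \<Rightarrow> None)"
  by (cases "act a r") (auto simp: pos_def[of a "Suc r"] conf_Suc Let_def)

lemma seen_eq: "seen a r = (case status (conf r a) of
    Dormant \<Rightarrow> if wake X a = Some r \<or> (\<exists>b\<in>team X - {a}. pos b r = pos a r)
      then Active [obs a r] else Dormant
  | Active h \<Rightarrow> Active (obs a r # h)
  | Terminated \<Rightarrow> Terminated)"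
  by (auto simp: seen_def perceive_def obs_def crowd_def pos_def Let_def split: status.split)

lemma dormant_before: "(\<And>r'. r' < r \<Longrightarrow> seen a r' = Dormant) \<Longrightarrow>
    status (conf r a) = Dormant \<and> pos a r = start X a \<and> entry (conf r a) = None"
proof (induction r)
  case 0
  show ?case by (simp add: conf_def pos_def)
next
  case (Suc r)
  then show ?case using Suc.prems[of r] by (simp add: status_Suc pos_Suc entry_Suc)
qed

lemma first_wake_ex: "\<exists>a\<in>team X. wake X a = Some (first_wake X)"
proof -
  obtain a r where "a \<in> team X" "wake X a = Some r" using valid_X by (auto simp: valid_scenario_def)
  then show ?thesis
    unfolding first_wake_def using LeastI[of "\<lambda>r. \<exists>a\<in>team X. wake X a = Some r" r] by blast
qed

text \<open>Until then everybody is at its own starting node; these are distinct, so no visit can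
  wake anyone.\<close>

lemma dormant_before_first_wake:
  assumes "r < first_wake X" "a \<in> team X"
  shows "seen a r = Dormant"
  using assms
proof (induction r arbitrary: a rule: less_induct)
  case (less r)
  have *: "status (conf r b) = Dormant \<and> pos b r = start X b" if "b \<in> team X" for b
    using dormant_before[of r b] less.IH that less.prems(1) by auto
  have "wake X a \<noteq> Some r"
    using not_less_Least[of r "\<lambda>r. \<exists>a\<in>team X. wake X a = Some r"] less.prems
    unfolding first_wake_def by blast
  moreover have "pos b r \<noteq> pos a r" if "b \<in> team X - {a}" for b
    using * that less.prems(2) start_inj by (auto simp: inj_on_def)
  ultimately show ?case using *[OF less.prems(2)] by (auto simp: seen_eq)
qed

lemma seen_woken:
  assumes "\<exists>r. seen a r \<noteq> Dormant"
  shows "seen a (woken a) = Active (history a (woken a))"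
    "r \<le> woken a \<Longrightarrow> pos a r = start X a \<and> entry (conf r a) = None"
proof -
  have ne: "seen a (woken a) \<noteq> Dormant"
    unfolding woken_def using assms by (rule LeastI_ex)
  have before: "seen a r = Dormant" if "r < woken a" for r
    using not_less_Least that unfolding woken_def by blast
  show "r \<le> woken a \<Longrightarrow> pos a r = start X a \<and> entry (conf r a) = None"
    using dormant_before[of r a] before by simp
  have "status (conf (woken a) a) = Dormant" using dormant_before before by blast
  then show "seen a (woken a) = Active (history a (woken a))"
    using ne by (auto simp: seen_eq history_def split: if_splits)
qed

lemma seen_Suc:
  assumes "seen a r = Active (history a r)" "\<And>L. act a r \<noteq> Declare L" "woken a \<le> r"
  shows "seen a (Suc r) = Active (history a (Suc r))"
  using assms by (auto simp: seen_eq[of a "Suc r"] status_Suc history_def split: action.split)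

lemma act_eq:
  assumes "seen a r = Active (history a r)" "woken a \<le> r" "\<tau> = r + B - woken a"
  shows "act a r = gather_action N a (code a r) (\<tau> div (4 * B)) (\<tau> mod (4 * B))"
proof -
  have "clock N (code a r) = \<tau>"
    using assms(2,3) by (simp add: clock_def code_def history_def B_def del: upt_Suc)
  then show ?thesis
    by (simp add: assms(1) gather_def code_def B_def)
qed

lemma history_nth_code:
  assumes "i \<le> r - woken a" "woken a \<le> r"
  shows "history_nth (code a r) i = encode_observation (obs a (r - i))"
proof -
  have "i < length (history a r)" using assms by (simp add: history_def)
  moreover have "history a r ! i = obs a (r - i)"
    using assms unfolding history_def by (subst nth_map) (auto simp: rev_nth simp del: upt_Suc)
  ultimately show ?thesis by (simp add: code_def history_nth_encode)
qed

lemma entry_ago_code: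
  assumes "i \<le> r - woken a" "woken a \<le> r"
  shows "entry_ago (code a r) i = (case entry (conf (r - i) a) of None \<Rightarrow> 0 | Some p \<Rightarrow> Suc p)"
  using history_nth_code[OF assms] by (simp add: entry_ago_def obs_def)

lemma count_ago_code:
  assumes "i \<le> r - woken a" "woken a \<le> r"
  shows "count_ago (code a r) i = crowd a (r - i)"
  using history_nth_code[OF assms] by (simp add: count_ago_def obs_def)

lemma leader_0: "leader N H 0 = 1"
proof -
  have "leader N H 0 = (LEAST L. 1 \<le> L)" by (simp add: leader_def elected_def)
  also have "\<dots> = 1" by (rule Least_equality) auto
  finally show ?thesis .
qed

text \<open>In slot 0 every code has its bit set and there is nothing earlier to compare, so these
  moves do not depend on observations. They are settled before the general invariant, which relies
  on the wake-up bounds.\<close>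

lemma first_tour:
  assumes "\<exists>r. seen a r \<noteq> Dormant"
  shows "k \<le> B \<Longrightarrow> seen a (woken a + k) = Active (history a (woken a + k)) \<and> pos a (woken a + k) = path (start X a) k"
proof (induction k)
  case 0
  then show ?case using seen_woken[OF assms] by (simp add: path_def)
next
  case (Suc k)
  have "act a (woken a + k) = gather_action N a (code a (woken a + k)) 0 (k + B)"
    using act_eq[of a "woken a + k" "k + B"] Suc by simp
  also have "\<dots> = Move (exploration N k)"
    using Suc.prems by (simp add: gather_action_def leader_0 election_action_def label_code_def
        tour_action_def B_def[symmetric])
  finally have "act a (woken a + k) = Move (exploration N k)" .
  then show ?case using Suc seen_Suc[of a "woken a + k"] by (simp add: pos_Suc path_def)
qed

lemma path_covers: "v \<in> nodes (net X) \<Longrightarrow> w \<in> nodes (net X) \<Longrightarrow> \<exists>k\<le>B. path v k = w"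
  unfolding path_def B_def by (rule exploration_covers[OF size])

lemma path_0: "path v 0 = v"
  by (simp add: path_def)

lemma path_Suc: "path v (Suc k) = move (net X) (path v k) (exploration N k)"
  by (simp add: path_def)

lemma path_in_nodes: "v \<in> nodes (net X) \<Longrightarrow> path v k \<in> nodes (net X)"
  by (simp add: path_def walk_in_nodes)

text \<open>The outward tour of an agent woken in round \<open>first_wake X\<close> reaches every
  starting node within \<open>B\<close> rounds.\<close>

lemma woken_bounds:
  assumes "a \<in> team X"
  shows "\<exists>r. seen a r \<noteq> Dormant" "first_wake X \<le> woken a" "woken a \<le> first_wake X + B"
proof -
  obtain c where c: "c \<in> team X" "wake X c = Some (first_wake X)" using first_wake_ex by blast
  have "status (conf (first_wake X) c) = Dormant"
    using dormant_before dormant_before_first_wake c(1) by blast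
  then have aw: "seen c (first_wake X) \<noteq> Dormant" using c(2) by (simp add: seen_eq)
  then have ex: "\<exists>r. seen c r \<noteq> Dormant" by blast
  have "woken c = first_wake X"
    unfolding woken_def using aw dormant_before_first_wake[OF _ c(1)]
    by (intro Least_equality) (auto simp: not_less[symmetric])
  then have tour: "pos c (first_wake X + k) = path (start X c) k" if "k \<le> B" for k
    using first_tour[OF ex that] by simp
  obtain k where k: "k \<le> B" "path (start X c) k = start X a"
    using path_covers start_in_nodes c(1) assms by blast
  have "\<exists>r\<le>first_wake X + k. seen a r \<noteq> Dormant"
  proof (rule ccontr)
    assume *: "\<not> ?thesis"
    then have st: "status (conf (first_wake X + k) a) = Dormant"
      and p: "pos a (first_wake X + k) = start X a"
      using dormant_before[of "first_wake X + k" a] by auto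
    have "a \<noteq> c" using * aw le_add1 by blast
    moreover have "pos c (first_wake X + k) = pos a (first_wake X + k)" using tour k p by simp
    ultimately have "seen a (first_wake X + k) \<noteq> Dormant"
      using st c(1) by (auto simp: seen_eq)
    with * show False by blast
  qed
  then obtain r where r: "r \<le> first_wake X + k" "seen a r \<noteq> Dormant" by blast
  show "\<exists>r. seen a r \<noteq> Dormant" using r by blast
  have "woken a \<le> r" unfolding woken_def using r(2) by (rule Least_le)
  with r k show "woken a \<le> first_wake X + B" by linarith
  have "seen a (woken a) \<noteq> Dormant" unfolding woken_def using r(2) by (rule LeastI)
  then show "first_wake X \<le> woken a" using dormant_before_first_wake[OF _ assms] by (meson not_le)
qed

end

section \<open>Correctness of the algorithm\<close>

context gathering
begin

section \<open>The invariant: predicted positions, statuses and ports of entry\<close>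

definition winner :: nat where
  "winner = (SOME L. L \<in> team X \<and> (\<forall>j\<le>2 * bit_length L. contested (team X) j \<longleftrightarrow> label_code L j))"

text \<open>The length of the winner's code, hence the number of election slots; assembly begins in
  slot \<open>F\<close>.\<close>

definition F :: nat where "F = Suc (2 * bit_length winner)"

definition slot :: "nat \<Rightarrow> nat" where "slot j = 4 * B * j"

definition active :: "nat \<Rightarrow> nat \<Rightarrow> bool" where
  "active a s \<longleftrightarrow> a \<in> alive (team X) s \<and> label_code a s"

abbreviation trail :: "nat \<Rightarrow> nat" where "trail \<equiv> path (start X winner)"

definition attached :: "nat \<Rightarrow> nat \<Rightarrow> bool" where
  "attached a k \<longleftrightarrow> (\<exists>j\<le>k. trail j = start X a)"

text \<open>Truncated subtraction makes the tour index 0 in the first and the last quarter of a slot.\<close>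

definition target :: "nat \<Rightarrow> nat \<Rightarrow> nat \<Rightarrow> nat" where
  "target a s \<rho> =
     (if s < F then if active a s then path (start X a) (min (\<rho> - B) (3 * B - \<rho>)) else start X a
      else if attached a (s - F) then trail (min B (s - F + (if B < \<rho> then 1 else 0)))
      else start X a)"

definition entry_port :: "nat \<Rightarrow> nat \<Rightarrow> nat option" where
  "entry_port v k = (if exploration N k < degree_at (net X) (path v k)
     then Some (port (net X) (path v (Suc k)) (path v k)) else None)"

definition status_ok :: "nat \<Rightarrow> nat \<Rightarrow> bool" where
  "status_ok a r \<longleftrightarrow> woken a \<le> r \<longrightarrow>
     seen a r = (if r + B \<le> woken a + slot (F + B) then Active (history a r) else Terminated)"

text \<open>The exact port of entry is tracked in the outward half of a tour, since backtracking
  reads it. Elsewhere the invariant limits when a port of entry may be present, as silence in a slot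
  requires.\<close>

definition place_ok :: "nat \<Rightarrow> nat \<Rightarrow> bool" where
  "place_ok a r \<longleftrightarrow> (\<forall>s \<rho>. woken a \<le> r \<and> r + B = woken a + slot s + \<rho> \<and> \<rho> < 4 * B \<longrightarrow>
     pos a r = target a s \<rho> \<and>
     (entry (conf r a) \<noteq> None \<longrightarrow> B < \<rho> \<and> (if s < F then active a s else attached a (s - F))) \<and>
     (s < F \<and> active a s \<and> B < \<rho> \<and> \<rho> \<le> 2 * B \<longrightarrow> entry (conf r a) = entry_port (start X a) (\<rho> - Suc B)))"

text \<open>\<open>noise\<close> in terms of rounds of the execution instead of a coded history.
  Adding \<open>B\<close> to the round gives the offset of the clock at wake-up without truncated
  subtraction.\<close>

definition noisy :: "nat \<Rightarrow> nat \<Rightarrow> bool" where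
  "noisy a j \<longleftrightarrow> (\<exists>r. woken a \<le> r \<and> woken a + slot j \<le> r + B \<and> r + B < woken a + slot j + 4 * B \<and>
     (entry (conf r a) \<noteq> None \<or> 2 \<le> crowd a r))"

lemma slot_0 [simp]: "slot 0 = 0"
  by (simp add: slot_def)

lemma slot_Suc [simp]: "slot (Suc j) = slot j + 4 * B"
  by (simp add: slot_def)

lemma slot_mono: "i \<le> j \<Longrightarrow> slot i \<le> slot j"
  by (simp add: slot_def)

lemma slot_less: "i < j \<Longrightarrow> slot i + 4 * B \<le> slot j"
  using slot_mono[of "Suc i" j] by simp

lemma slot_split:
  assumes "\<rho> < 4 * B"
  shows "(slot s + \<rho>) div (4 * B) = s" "(slot s + \<rho>) mod (4 * B) = \<rho>"
  using assms B_pos by (auto simp: slot_def)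

lemma slot_unique: "slot s + \<rho> = slot s' + \<rho>' \<Longrightarrow> \<rho> < 4 * B \<Longrightarrow> \<rho>' < 4 * B \<Longrightarrow> s = s' \<and> \<rho> = \<rho>'"
  by (metis slot_split)

lemma team_nonempty: "team X \<noteq> {}"
  using team_card by auto

lemma winner_in_team: "winner \<in> team X"
  and winner_code: "j < F \<Longrightarrow> contested (team X) j \<longleftrightarrow> label_code winner j"
proof -
  have "\<exists>L. L \<in> team X \<and> (\<forall>j\<le>2 * bit_length L. contested (team X) j \<longleftrightarrow> label_code L j)"
    using exists_winner[OF finite_team team_nonempty] by blast
  then have "winner \<in> team X \<and> (\<forall>j\<le>2 * bit_length winner. contested (team X) j \<longleftrightarrow> label_code winner j)"
    unfolding winner_def by (rule someI_ex)
  then show "winner \<in> team X" "j < F \<Longrightarrow> contested (team X) j \<longleftrightarrow> label_code winner j"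
    unfolding F_def less_Suc_eq_le by blast+
qed

lemma contested_iff: "contested (team X) s \<longleftrightarrow> (\<exists>a\<in>team X. active a s)"
  unfolding contested_def active_def using alive_eq[of "team X" s] by blast

lemma active_0: "a \<in> team X \<Longrightarrow> active a 0"
  by (simp add: active_def label_code_def)

lemma F_pos: "0 < F"
  by (simp add: F_def)

text \<open>An elected label and the winner both match the noise on the shorter of their codes, so
  prefix-freeness identifies them. The winner is elected only once all its \<open>F\<close> slots
  are past; before that the default \<open>2 ^ s\<close> results.\<close>

lemma leader_eq:
  assumes "\<And>j. j < s \<Longrightarrow> j < F \<Longrightarrow> noise N H j \<longleftrightarrow> contested (team X) j"
  shows "leader N H s < 2 ^ s \<longleftrightarrow> F \<le> s" "F \<le> s \<Longrightarrow> leader N H s = winner"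
proof -
  have pos: "0 < winner" using label_pos winner_in_team by blast
  have noise: "noise N H j \<longleftrightarrow> label_code winner j" if "j < s" "j < F" for j
    using assms winner_code that by blast
  have unique: "L = winner" if L: "elected N H s L" for L
  proof (cases "bit_length L \<le> bit_length winner")
    case True
    show ?thesis
      by (rule label_code_prefix_free[symmetric])
         (use L pos noise True in \<open>auto simp: elected_def F_def less_Suc_eq_le\<close>)
  next
    case False
    show ?thesis
      by (rule label_code_prefix_free)
         (use L pos noise False in \<open>auto simp: elected_def F_def less_Suc_eq_le\<close>)
  qed
  have elected_winner: "elected N H s winner \<longleftrightarrow> F \<le> s"
    using noise pos by (auto simp: elected_def F_def)
  have "2 ^ bit_length winner \<le> (2::nat) ^ s" if "F \<le> s"
    using that by (intro power_increasing) (auto simp: F_def)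
  then have small: "winner < 2 ^ s" if "F \<le> s"
    using that less_bit_length[of winner] by linarith
  show leader: "leader N H s = winner" if "F \<le> s"
    unfolding leader_def
  proof (rule Least_equality)
    show "elected N H s winner \<or> 2 ^ s \<le> winner" using elected_winner that by blast
    show "winner \<le> L" if "elected N H s L \<or> 2 ^ s \<le> L" for L
      using that unique small[OF \<open>F \<le> s\<close>] by auto
  qed
  have "2 ^ s \<le> leader N H s" if "\<not> F \<le> s"
  proof -
    have "elected N H s (leader N H s) \<or> 2 ^ s \<le> leader N H s"
      unfolding leader_def by (rule LeastI[of _ "2 ^ s"]) simp
    then show ?thesis using unique elected_winner that by metis
  qed
  then show "leader N H s < 2 ^ s \<longleftrightarrow> F \<le> s" using leader small by (metis not_le)
qed

lemma attached_mono: "attached a j \<Longrightarrow> j \<le> k \<Longrightarrow> attached a k"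
  unfolding attached_def by (meson le_trans)

lemma attached_Suc: "attached a (Suc k) \<longleftrightarrow> attached a k \<or> trail (Suc k) = start X a"
  unfolding attached_def by (auto simp: le_Suc_eq)

lemma attached_winner: "attached winner k"
  unfolding attached_def by (auto intro!: exI[of _ 0] simp: path_0)

lemma attached_B:
  assumes "a \<in> team X" "B \<le> k"
  shows "attached a k"
  using path_covers[OF start_in_nodes[OF winner_in_team] start_in_nodes[OF assms(1)]] assms(2)
  unfolding attached_def by (meson le_trans)

section \<open>What agents hear, with clocks differing by at most \<open>B\<close>\<close>

lemma woken_diff: "a \<in> team X \<Longrightarrow> b \<in> team X \<Longrightarrow> woken a \<le> woken b + B"
  using woken_bounds(2)[of b] woken_bounds(3)[of a] by linarith

lemma before_woken: "a \<in> team X \<Longrightarrow> r \<le> woken a \<Longrightarrow> pos a r = start X a \<and> entry (conf r a) = None"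
  using seen_woken(2) woken_bounds(1) by blast

lemma start_eq_iff: "a \<in> team X \<Longrightarrow> b \<in> team X \<Longrightarrow> start X a = start X b \<longleftrightarrow> a = b"
  using start_inj by (auto simp: inj_on_def)

lemma placeD:
  assumes "place_ok a r" "woken a \<le> r" "r + B = woken a + slot s + \<rho>" "\<rho> < 4 * B"
  shows "pos a r = target a s \<rho>"
    and "entry (conf r a) \<noteq> None \<Longrightarrow> B < \<rho> \<and> (if s < F then active a s else attached a (s - F))"
    and "s < F \<Longrightarrow> active a s \<Longrightarrow> B < \<rho> \<Longrightarrow> \<rho> \<le> 2 * B \<Longrightarrow>
      entry (conf r a) = entry_port (start X a) (\<rho> - Suc B)"
  using assms unfolding place_ok_def by blast+

lemma crowd_iff:
  assumes "a \<in> team X"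
  shows "2 \<le> crowd a r \<longleftrightarrow> (\<exists>b\<in>team X. b \<noteq> a \<and> pos b r = pos a r)"
proof -
  let ?S = "{b \<in> team X. pos b r = pos a r}"
  have fin: "finite ?S" and aS: "a \<in> ?S" using finite_team assms by auto
  have "2 \<le> card ?S \<longleftrightarrow> ?S \<noteq> {a}"
  proof
    assume "2 \<le> card ?S" then show "?S \<noteq> {a}" by auto
  next
    assume "?S \<noteq> {a}"
    with aS have "card {a} < card ?S" by (intro psubset_card_mono fin) blast
    then show "2 \<le> card ?S" by simp
  qed
  then show ?thesis unfolding crowd_def using aS by blast
qed

text \<open>The window exceeds the slot by \<open>B\<close> on either side to allow for the shift of
  clocks. It meets only the last quarter of the slot before and the first quarter of the slot after,
  which are spent at home, even if the latter is the first assembly slot.\<close>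

lemma pos_near_idle_slot:
  assumes b: "b \<in> team X" and ok: "place_ok b r" and j: "j < F" "\<not> active b j"
    and r: "woken b + slot j \<le> r + 2 * B" "r + B < woken b + slot j + 5 * B"
  shows "pos b r = start X b"
proof (cases "r \<le> woken b")
  case True
  then show ?thesis using before_woken b by blast
next
  case False
  consider "r + B < woken b + slot j" | "woken b + slot j \<le> r + B" "r + B < woken b + slot (Suc j)"
    | "woken b + slot (Suc j) \<le> r + B" by linarith
  then show ?thesis
  proof cases
    case 1
    with False obtain i where i: "j = Suc i" by (cases j) auto
    define \<rho> where "\<rho> = r + B - woken b - slot i"
    have "r + B = woken b + slot i + \<rho>" "\<rho> < 4 * B" "3 * B \<le> \<rho>" using 1 r i by (auto simp: \<rho>_def)
    with placeD(1)[OF ok] False have "pos b r = target b i \<rho>" by auto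
    then show ?thesis using \<open>3 * B \<le> \<rho>\<close> i j by (simp add: target_def path_0)
  next
    case 2
    define \<rho> where "\<rho> = r + B - woken b - slot j"
    have "r + B = woken b + slot j + \<rho>" "\<rho> < 4 * B" using 2 r by (auto simp: \<rho>_def)
    with placeD(1)[OF ok] False have "pos b r = target b j \<rho>" by auto
    then show ?thesis using j by (simp add: target_def)
  next
    case 3
    define \<rho> where "\<rho> = r + B - woken b - slot (Suc j)"
    have \<rho>: "r + B = woken b + slot (Suc j) + \<rho>" "\<rho> < 4 * B" "\<rho> < B" using 3 r by (auto simp: \<rho>_def)
    with placeD(1)[OF ok _ \<rho>(1)] False have "pos b r = target b (Suc j) \<rho>" by auto
    then show ?thesis using \<rho>(3) j by (auto simp: target_def path_0 attached_def)
  qed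
qed

text \<open>A tour of self-loops only would never reach the start of a second agent. Hence a touring
  agent has a port of entry to hear its own bit by.\<close>

lemma tour_moves:
  assumes "a \<in> team X"
  shows "\<exists>k<B. entry_port (start X a) k \<noteq> None"
proof (rule ccontr)
  assume *: "\<not> ?thesis"
  have "path (start X a) k = start X a" if "k \<le> B" for k
    using that
  proof (induction k)
    case (Suc k)
    have "entry_port (start X a) k = None" using * Suc.prems by auto
    with Suc show ?case by (auto simp: path_Suc entry_port_def move_def split: if_splits)
  qed (simp add: path_0)
  moreover obtain b where "b \<in> team X" "b \<noteq> a"
    using team_card assms by (metis One_nat_def Suc_1 card_1_singleton_iff empty_iff insertI1
        not_less_eq_eq order_refl subsetI subset_singletonD is_singletonI' is_singleton_altdef)
  ultimately show False
    using path_covers[OF start_in_nodes start_in_nodes, of a b] start_eq_iff[of b a] assms by auto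
qed

text \<open>If nobody tours in slot \<open>j\<close>, all agents are at their distinct homes
  throughout the slot as timed by \<open>a\<close>. If \<open>a\<close> tours, it notices its own
  moves. Otherwise a touring agent visits the home of \<open>a\<close>, and being in the middle half
  of its own slot it does so within the same slot of \<open>a\<close>.\<close>

lemma noisy_election:
  assumes ok: "\<And>r' b. r' < r \<Longrightarrow> b \<in> team X \<Longrightarrow> place_ok b r'"
    and a: "a \<in> team X" and j: "j < F" and past: "woken a + slot (Suc j) \<le> r + B"
  shows "noisy a j \<longleftrightarrow> contested (team X) j"
proof
  assume "noisy a j"
  then obtain r' where r': "woken a \<le> r'" "woken a + slot j \<le> r' + B" "r' + B < woken a + slot j + 4 * B"
    and sign: "entry (conf r' a) \<noteq> None \<or> 2 \<le> crowd a r'"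
    by (auto simp: noisy_def)
  have "r' < r" using r' past by simp
  show "contested (team X) j"
  proof (rule ccontr)
    assume idle: "\<not> contested (team X) j"
    then have "j \<noteq> 0" using contested_0 team_nonempty by metis
    have inactive: "\<not> active b j" if "b \<in> team X" for b using idle contested_iff that by blast
    have home: "pos b r' = start X b" if b: "b \<in> team X" for b
    proof (rule pos_near_idle_slot[OF b])
      show "place_ok b r'" using ok \<open>r' < r\<close> b by blast
    qed (use r' woken_diff[OF a b] woken_diff[OF b a] j inactive[OF b] in auto)
    define \<rho> where "\<rho> = r' + B - woken a - slot j"
    have "r' + B = woken a + slot j + \<rho>" "\<rho> < 4 * B" using r' by (auto simp: \<rho>_def)
    from placeD(2)[OF ok[OF \<open>r' < r\<close> a] r'(1) this] have "entry (conf r' a) = None"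
      using inactive[OF a] j by metis
    with sign obtain b where "b \<in> team X" "b \<noteq> a" "pos b r' = pos a r'"
      using crowd_iff[OF a] by blast
    then show False using home a start_eq_iff by auto
  qed
next
  assume "contested (team X) j"
  then obtain b where b: "b \<in> team X" "active b j" using contested_iff by blast
  show "noisy a j"
  proof (cases "active a j")
    case True
    obtain k where k: "k < B" "entry_port (start X a) k \<noteq> None" using tour_moves[OF a] by blast
    define r' where "r' = woken a + slot j + Suc k"
    have r': "r' + B = woken a + slot j + (B + Suc k)" by (simp add: r'_def)
    have "r' < r" using past k(1) by (simp add: r'_def)
    have "entry (conf r' a) = entry_port (start X a) k"
      using placeD(3)[OF ok[OF \<open>r' < r\<close> a] _ r' _ j True] k(1) by (simp add: r'_def)
    then show ?thesis unfolding noisy_def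
      using k by (intro exI[of _ r']) (auto simp: r'_def)
  next
    case False
    \<comment> \<open>A positive slot number ensures that \<open>a\<close> is already awake when the
      visit occurs.\<close>
    then have "j \<noteq> 0" using active_0[OF a] by metis
    then have "4 * B \<le> slot j" using slot_less[of 0 j] by simp
    have "a \<noteq> b" using b False by blast
    obtain k where k: "k \<le> B" "path (start X b) k = start X a"
      using path_covers start_in_nodes a b by blast
    define r' where "r' = woken b + slot j + k"
    have r': "r' + B = woken b + slot j + (B + k)" by (simp add: r'_def)
    have near: "woken a \<le> woken b + B" "woken b \<le> woken a + B" using woken_diff a b by auto
    have "r' < r" using past k(1) near B_pos by (simp add: r'_def)
    have "pos b r' = target b j (B + k)"
      by (rule placeD(1)[OF ok[OF \<open>r' < r\<close> b(1)] _ r']) (use k B_pos in \<open>auto simp: r'_def\<close>)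
    also have "\<dots> = start X a"
    proof -
      have "min (B + k - B) (3 * B - (B + k)) = k" using k(1) by simp
      then show ?thesis using b(2) j k(2) by (simp add: target_def)
    qed
    finally have pb: "pos b r' = start X a" .
    define \<rho> where "\<rho> = r' + B - woken a - slot j"
    have \<rho>: "r' + B = woken a + slot j + \<rho>" "\<rho> < 4 * B" and wr: "woken a \<le> r'"
      using near k(1) B_pos \<open>4 * B \<le> slot j\<close> by (auto simp: \<rho>_def r'_def)
    have "pos a r' = start X a"
      using placeD(1)[OF ok[OF \<open>r' < r\<close> a] wr \<rho>] False j by (simp add: target_def)
    then have "2 \<le> crowd a r'" using crowd_iff[OF a] pb b(1) \<open>a \<noteq> b\<close> by metis
    then show ?thesis unfolding noisy_def
      using \<rho> wr by (intro exI[of _ r']) auto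
  qed
qed

text \<open>A visitor at the home of the unattached \<open>a\<close> must be on the trail. Within
  the shift of clocks it can only be at trail index \<open>j\<close> or \<open>Suc j\<close>, and
  index \<open>j\<close> is excluded because \<open>a\<close> is unattached. Conversely the winner
  itself makes the visit.\<close>

lemma noisy_assembly:
  assumes ok: "\<And>r' b. r' < r \<Longrightarrow> b \<in> team X \<Longrightarrow> place_ok b r'"
    and a: "a \<in> team X" and j: "j < B" "\<not> attached a j" and past: "woken a + slot (Suc (F + j)) \<le> r + B"
  shows "noisy a (F + j) \<longleftrightarrow> trail (Suc j) = start X a"
proof
  assume "noisy a (F + j)"
  then obtain r' where r': "woken a \<le> r'" "woken a + slot (F + j) \<le> r' + B"
    "r' + B < woken a + slot (F + j) + 4 * B"
    and sign: "entry (conf r' a) \<noteq> None \<or> 2 \<le> crowd a r'"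
    by (auto simp: noisy_def)
  have "r' < r" using r' past by simp
  define \<rho> where "\<rho> = r' + B - woken a - slot (F + j)"
  have \<rho>: "r' + B = woken a + slot (F + j) + \<rho>" "\<rho> < 4 * B" using r' by (auto simp: \<rho>_def)
  have "entry (conf r' a) = None"
    using placeD(2)[OF ok[OF \<open>r' < r\<close> a] r'(1) \<rho>] j(2) by (metis add_diff_cancel_left' not_add_less1)
  moreover have pa: "pos a r' = start X a"
    using placeD(1)[OF ok[OF \<open>r' < r\<close> a] r'(1) \<rho>] j by (simp add: target_def)
  ultimately obtain b where b: "b \<in> team X" "b \<noteq> a" "pos b r' = start X a"
    using sign crowd_iff[OF a] by metis
  have away: "start X b \<noteq> start X a" using b a start_eq_iff by blast
  have unvisited: "trail i \<noteq> start X a" if "i \<le> j" for i using j that by (auto simp: attached_def)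
  have near: "woken a \<le> woken b + B" "woken b \<le> woken a + B" using woken_diff a b by auto
  have "4 * B \<le> slot (F + j)" using slot_less[of 0 "F + j"] F_pos by simp
  then have wr: "woken b \<le> r'" using near r' by linarith
  consider "r' + B < woken b + slot (F + j)"
    | "woken b + slot (F + j) \<le> r' + B" "r' + B < woken b + slot (Suc (F + j))"
    | "woken b + slot (Suc (F + j)) \<le> r' + B" by linarith
  then show "trail (Suc j) = start X a"
  proof cases
    case 1
    define i where "i = F + j - 1"
    have i: "F + j = Suc i" using F_pos by (simp add: i_def)
    define \<sigma> where "\<sigma> = r' + B - woken b - slot i"
    have "r' + B = woken b + slot i + \<sigma>" "\<sigma> < 4 * B" "3 * B \<le> \<sigma>"
      using 1 r' near i by (auto simp: \<sigma>_def)
    with placeD(1)[OF ok[OF \<open>r' < r\<close> b(1)] wr] have "target b i \<sigma> = start X a" using b by auto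
    moreover have "target b i \<sigma> \<noteq> start X a"
    \<comment> \<open>For \<open>j = 0\<close> the previous slot is the last election slot, whose
      final quarter is spent at home.\<close>
    proof (cases "j = 0")
      case True
      then show ?thesis using \<open>3 * B \<le> \<sigma>\<close> i away by (simp add: target_def path_0)
    next
      case False
      then have "i - F + 1 = j" "F \<le> i" using i by auto
      then show ?thesis using \<open>3 * B \<le> \<sigma>\<close> B_pos away unvisited[of j] j(1) by (auto simp: target_def)
    qed
    ultimately show ?thesis by blast
  next
    case 2
    define \<sigma> where "\<sigma> = r' + B - woken b - slot (F + j)"
    have "r' + B = woken b + slot (F + j) + \<sigma>" "\<sigma> < 4 * B" using 2 by (auto simp: \<sigma>_def)
    with placeD(1)[OF ok[OF \<open>r' < r\<close> b(1)] wr] have "target b (F + j) \<sigma> = start X a" using b by auto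
    then show ?thesis using away unvisited[of j] j(1) by (auto simp: target_def split: if_splits)
  next
    case 3
    define \<sigma> where "\<sigma> = r' + B - woken b - slot (Suc (F + j))"
    have \<sigma>: "r' + B = woken b + slot (Suc (F + j)) + \<sigma>" "\<sigma> < 4 * B" "\<sigma> \<le> B"
      using 3 r' near by (auto simp: \<sigma>_def)
    with placeD(1)[OF ok[OF \<open>r' < r\<close> b(1)] wr \<sigma>(1,2)]
    have "target b (Suc (F + j)) \<sigma> = start X a" using b by auto
    then show ?thesis using away j(1) \<sigma>(3) by (auto simp: target_def Suc_diff_le split: if_splits)
  qed
next
  assume visit: "trail (Suc j) = start X a"
  have "a \<noteq> winner" using attached_winner j by blast
  have b: "winner \<in> team X" by (rule winner_in_team)
  have near: "woken a \<le> woken winner + B" "woken winner \<le> woken a + B" using woken_diff a b by auto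
  \<comment> \<open>This is offset \<open>2 * B\<close> of the winner's slot: after the step made at
    offset \<open>B\<close>, and far enough from both ends to fall into the same slot of
    \<open>a\<close>.\<close>
  define r' where "r' = woken winner + slot (F + j) + B"
  have r': "r' + B = woken winner + slot (F + j) + 2 * B" by (simp add: r'_def)
  have "r' < r" using past near B_pos by (simp add: r'_def)
  have "pos winner r' = target winner (F + j) (2 * B)"
    by (rule placeD(1)[OF ok[OF \<open>r' < r\<close> b] _ r']) (use B_pos in \<open>auto simp: r'_def\<close>)
  also have "\<dots> = start X a" using visit attached_winner B_pos j(1) by (simp add: target_def)
  finally have pb: "pos winner r' = start X a" .
  define \<rho> where "\<rho> = r' + B - woken a - slot (F + j)"
  have \<rho>: "r' + B = woken a + slot (F + j) + \<rho>" "\<rho> < 4 * B" and wr: "woken a \<le> r'"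
    using near B_pos by (auto simp: \<rho>_def r'_def)
  have "pos a r' = start X a"
    using placeD(1)[OF ok[OF \<open>r' < r\<close> a] wr \<rho>] j by (simp add: target_def)
  then have "2 \<le> crowd a r'" using crowd_iff[OF a] pb b \<open>a \<noteq> winner\<close> by metis
  then show "noisy a (F + j)" unfolding noisy_def
    using \<rho> wr by (intro exI[of _ r']) auto
qed

lemma noise_eq:
  assumes "woken a \<le> r" "woken a + slot (Suc j) \<le> r + B"
  shows "noise N (code a r) j \<longleftrightarrow> noisy a j"
proof -
  have clock: "clock N (code a r) = r + B - woken a"
    using assms(1) by (simp add: clock_def code_def history_def B_def del: upt_Suc)
  have eq: "r - (r + B - woken a - (slot j + t)) = woken a + (slot j + t) - B"
    "r + B - woken a - (slot j + t) \<le> r - woken a" if "t < 4 * B" "B \<le> slot j + t" for t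
    using that assms by auto
  have port_code: "(case p of None \<Rightarrow> 0 | Some q \<Rightarrow> Suc q) \<noteq> 0 \<longleftrightarrow> p \<noteq> None" for p
    by (cases p) auto
  have "noise N (code a r) j \<longleftrightarrow> (\<exists>t<4 * B. B \<le> slot j + t \<and>
      (entry (conf (woken a + (slot j + t) - B) a) \<noteq> None \<or> 2 \<le> crowd a (woken a + (slot j + t) - B)))"
    unfolding noise_def clock B_def[symmetric] slot_def[symmetric]
    by (intro ex_cong1 conj_cong refl)
       (simp only: entry_ago_code[OF eq(2) assms(1)] count_ago_code[OF eq(2) assms(1)] eq(1) port_code)
  also have "\<dots> \<longleftrightarrow> noisy a j"
  proof
    assume "noisy a j"
    then obtain r' where r': "woken a \<le> r'" "woken a + slot j \<le> r' + B" "r' + B < woken a + slot j + 4 * B"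
      "entry (conf r' a) \<noteq> None \<or> 2 \<le> crowd a r'" by (auto simp: noisy_def)
    then have "woken a + (slot j + (r' + B - woken a - slot j)) - B = r'" by simp
    with r' show "\<exists>t<4 * B. B \<le> slot j + t \<and> (entry (conf (woken a + (slot j + t) - B) a) \<noteq> None \<or>
        2 \<le> crowd a (woken a + (slot j + t) - B))"
      by (intro exI[of _ "r' + B - woken a - slot j"]) auto
  next
    assume "\<exists>t<4 * B. B \<le> slot j + t \<and> (entry (conf (woken a + (slot j + t) - B) a) \<noteq> None \<or>
        2 \<le> crowd a (woken a + (slot j + t) - B))"
    then obtain t where t: "t < 4 * B" "B \<le> slot j + t"
      "entry (conf (woken a + (slot j + t) - B) a) \<noteq> None \<or> 2 \<le> crowd a (woken a + (slot j + t) - B)"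
      by blast
    then show "noisy a j"
      unfolding noisy_def by (intro exI[of _ "woken a + (slot j + t) - B"] conjI) auto
  qed
  finally show ?thesis .
qed

text \<open>The invariant for earlier rounds makes every completed slot heard correctly, so the
  decisions based on the history reduce to the predicted ones.\<close>

lemma act_cases:
  assumes ok: "\<And>r' b. r' < r \<Longrightarrow> b \<in> team X \<Longrightarrow> place_ok b r'"
    and a: "a \<in> team X" and r: "woken a \<le> r" "r + B = woken a + slot s + \<rho>" "\<rho> < 4 * B"
    and seen: "seen a r = Active (history a r)"
  shows "act a r = (if s < F then if active a s then tour_action N (code a r) \<rho> else Stay
    else if B \<le> s - F then Declare winner
    else if \<rho> = B \<and> attached a (s - F) then Move (exploration N (s - F)) else Stay)"
proof -
  let ?H = "code a r"
  have act: "act a r = gather_action N a ?H s \<rho>"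
    using act_eq[OF seen r(1), of "slot s + \<rho>"] r(2) slot_split[OF r(3)] by simp
  have past: "woken a + slot (Suc j) \<le> r + B" if "j < s" for j
    using slot_mono[of "Suc j" s] that r(2) by simp
  have noise: "noise N ?H j \<longleftrightarrow> noisy a j" if "j < s" for j
    by (rule noise_eq[OF r(1) past[OF that]])
  have contested: "noise N ?H j \<longleftrightarrow> contested (team X) j" if "j < s" "j < F" for j
    using noisy_election[OF ok a that(2) past[OF that(1)]] noise[OF that(1)] by blast
  note leader = leader_eq[of s ?H, OF contested]
  show ?thesis
  proof (cases "s < F")
    case True
    then have "(label_code a s \<and> (\<forall>i<s. noise N ?H i \<longleftrightarrow> label_code a i)) \<longleftrightarrow> active a s"
      using contested a by (auto simp: active_def alive_eq)
    then show ?thesis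
      using True leader(1) by (simp add: act gather_action_def election_action_def not_less[symmetric])
  next
    case False
    have att: "(a = winner \<or> (\<exists>j<s - F. noise N ?H (F + j))) \<longleftrightarrow> attached a (s - F)" if "s - F < B"
    proof
      assume "a = winner \<or> (\<exists>j<s - F. noise N ?H (F + j))"
      then show "attached a (s - F)"
      proof
        assume "\<exists>j<s - F. noise N ?H (F + j)"
        then obtain j where j: "j < s - F" "noisy a (F + j)" using noise by fastforce
        then have past': "woken a + slot (Suc (F + j)) \<le> r + B" using past[of "F + j"] by simp
        have "attached a (Suc j)"
        proof (cases "attached a j")
          case False
          then have "trail (Suc j) = start X a"
            using noisy_assembly[OF ok a _ False past'] j that by auto
          then show ?thesis by (simp add: attached_Suc)
        qed (simp add: attached_Suc)
        then show ?thesis using attached_mono j(1) by (metis Suc_leI)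
      qed (simp add: attached_winner)
    next
      assume "attached a (s - F)"
      then obtain i where i: "i \<le> s - F" "trail i = start X a" by (auto simp: attached_def)
      \<comment> \<open>The first visit is taken because \<open>noisy_assembly\<close> only concerns
        slots before attachment; index 0 means that \<open>a\<close> is the winner.\<close>
      define j where "j = (LEAST j. trail j = start X a)"
      have j: "trail j = start X a" unfolding j_def using i(2) by (rule LeastI)
      have "j \<le> i" unfolding j_def using i(2) by (rule Least_le)
      have before: "\<not> trail k = start X a" if "k < j" for k
        using that not_less_Least unfolding j_def by blast
      show "a = winner \<or> (\<exists>j<s - F. noise N ?H (F + j))"
      proof (cases j)
        case 0
        then show ?thesis using j start_eq_iff[OF winner_in_team a] by (simp add: path_0)
      next
        case (Suc k)
        have k: "k < s - F" using Suc \<open>j \<le> i\<close> i(1) by simp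
        have "\<not> attached a k" using before Suc by (auto simp: attached_def)
        moreover have "woken a + slot (Suc (F + k)) \<le> r + B" using past[of "F + k"] k by simp
        ultimately have "noisy a (F + k)"
          using noisy_assembly[OF ok a] j Suc k that by auto
        then show ?thesis using k noise[of "F + k"] by auto
      qed
    qed
    have "s - Suc (2 * bit_length winner) = s - F" by (simp add: F_def)
    then show ?thesis
      using False leader att by (auto simp: act gather_action_def assembly_action_def B_def[symmetric] F_def[symmetric])
  qed
qed

section \<open>Preservation of the invariant by one round\<close>

lemma place_okI:
  assumes "r + B = woken a + slot s + \<rho>" "\<rho> < 4 * B" "pos a r = target a s \<rho>"
    and "entry (conf r a) \<noteq> None \<Longrightarrow> B < \<rho> \<and> (if s < F then active a s else attached a (s - F))"
    and "s < F \<Longrightarrow> active a s \<Longrightarrow> B < \<rho> \<Longrightarrow> \<rho> \<le> 2 * B \<Longrightarrow>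
      entry (conf r a) = entry_port (start X a) (\<rho> - Suc B)"
  shows "place_ok a r"
  unfolding place_ok_def
proof (intro allI impI)
  fix s' \<rho>' assume "woken a \<le> r \<and> r + B = woken a + slot s' + \<rho>' \<and> \<rho>' < 4 * B"
  then have "s' = s \<and> \<rho>' = \<rho>" using slot_unique[of s' \<rho>' s \<rho>] assms(1,2) by simp
  then show "pos a r = target a s' \<rho>' \<and>
     (entry (conf r a) \<noteq> None \<longrightarrow> B < \<rho>' \<and> (if s' < F then active a s' else attached a (s' - F))) \<and>
     (s' < F \<and> active a s' \<and> B < \<rho>' \<and> \<rho>' \<le> 2 * B \<longrightarrow>
      entry (conf r a) = entry_port (start X a) (\<rho>' - Suc B))"
    using assms(3-5) by blast
qed

lemma place_ok_idle:
  assumes q: "q + B = woken a + slot s + \<rho>" "\<rho> < 4 * B"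
    and pos: "pos a (Suc q) = target a s \<rho>" and entry: "entry (conf (Suc q) a) = None"
    and same: "Suc \<rho> < 4 * B \<Longrightarrow> target a s (Suc \<rho>) = target a s \<rho>"
    and "next": "Suc \<rho> = 4 * B \<Longrightarrow> target a (Suc s) 0 = target a s \<rho>"
    and out: "\<not> (s < F \<and> active a s \<and> B \<le> \<rho> \<and> \<rho> < 2 * B)"
  shows "place_ok a (Suc q)"
proof (cases "Suc \<rho> < 4 * B")
  case True
  show ?thesis
    by (rule place_okI[of _ _ s "Suc \<rho>"]) (use q True pos entry same out in auto)
next
  case False
  then have "Suc \<rho> = 4 * B" using q by simp
  then show ?thesis
    by (intro place_okI[of _ _ "Suc s" 0]) (use q pos entry "next" B_pos in auto)
qed

lemma target_early:
  assumes "s \<le> F" "\<rho> \<le> B"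
  shows "target a s \<rho> = start X a"
  using assms by (auto simp: target_def path_0 attached_def)

lemma place_ok_election_step:
  assumes ok: "\<And>r'. r' \<le> q \<Longrightarrow> place_ok a r'" and a: "a \<in> team X"
    and q: "woken a \<le> q" "q + B = woken a + slot s + \<rho>" "\<rho> < 4 * B" and s: "s < F"
    and act: "act a q = (if active a s then tour_action N (code a q) \<rho> else Stay)"
  shows "place_ok a (Suc q)"
proof -
  let ?p = "path (start X a)"
  have pos_q: "pos a q = target a s \<rho>" by (rule placeD(1)[OF ok q]) simp
  show ?thesis
  proof (cases "active a s \<and> B \<le> \<rho> \<and> \<rho> < 3 * B")
    case False
    then have "act a q = Stay" by (auto simp: act tour_action_def B_def[symmetric])
    then have "pos a (Suc q) = target a s \<rho>" "entry (conf (Suc q) a) = None"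
      using pos_q by (simp_all add: pos_Suc entry_Suc)
    moreover have *: "target a s \<rho> = start X a"
      using False s by (auto simp: target_def path_0)
    moreover have "target a s (Suc \<rho>) = start X a"
      using False s by (auto simp: target_def path_0)
    ultimately show ?thesis
      using q False target_early[of "Suc s" 0 a] s
      by (intro place_ok_idle[OF q(2,3)]) auto
  next
    case True
    then have active: "active a s" and B\<rho>: "B \<le> \<rho>" "\<rho> < 3 * B" by auto
    have new: "Suc q + B = woken a + slot s + Suc \<rho>" "Suc \<rho> < 4 * B" using q B\<rho> B_pos by auto
    show ?thesis
    proof (cases "\<rho> < 2 * B")
      case True
      define k where "k = \<rho> - B"
      have k: "\<rho> = B + k" "k < B" using B\<rho> True by (auto simp: k_def)
      have "act a q = Move (exploration N k)"
        using active k by (simp add: act tour_action_def B_def[symmetric])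
      moreover have "min (\<rho> - B) (3 * B - \<rho>) = k" using k by simp
      then have "pos a q = ?p k" using pos_q active s by (simp add: target_def)
      ultimately have p: "pos a (Suc q) = ?p (Suc k)" and e: "entry (conf (Suc q) a) = entry_port (start X a) k"
        by (auto simp: pos_Suc entry_Suc path_Suc entry_port_def)
      have "min (Suc \<rho> - B) (3 * B - Suc \<rho>) = Suc k" using k by simp
      then have "target a s (Suc \<rho>) = ?p (Suc k)" using active s by (simp add: target_def)
      then show ?thesis
        using p e k active s by (intro place_okI[OF new]) auto
    next
      case False
      define m where "m = 3 * B - Suc \<rho>"
      \<comment> \<open>Going back \<open>i\<close> rounds reflects offset \<open>\<rho>\<close> to
        \<open>4 * B - \<rho>\<close>, the offset just after outward step \<open>m\<close>, where
        the port to be used was observed.\<close>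
      define i where "i = 2 * (\<rho> - 2 * B)"
      have m: "3 * B - \<rho> = Suc m" using B\<rho> by (simp add: m_def)
      have "min (\<rho> - B) (3 * B - \<rho>) = Suc m" using False m by simp
      then have pq: "pos a q = ?p (Suc m)" using pos_q active s by (simp add: target_def)
      have "min (Suc \<rho> - B) (3 * B - Suc \<rho>) = m" using False m by simp
      then have tgt: "target a s (Suc \<rho>) = ?p m" using active s by (simp add: target_def)
      have i: "i \<le> q - woken a" using q B\<rho> False by (simp add: i_def)
      have then_: "(q - i) + B = woken a + slot s + (4 * B - \<rho>)" "4 * B - \<rho> < 4 * B" "woken a \<le> q - i"
        using q B\<rho> False i B_pos by (auto simp: i_def)
      have "entry (conf (q - i) a) = entry_port (start X a) (4 * B - \<rho> - Suc B)"
        by (rule placeD(3)[OF ok then_(3,1,2) s active]) (use B\<rho> False in auto)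
      also have "4 * B - \<rho> - Suc B = m" using B\<rho> by (simp add: m_def)
      finally have entry: "entry_ago (code a q) i = (case entry_port (start X a) m of None \<Rightarrow> 0 | Some p \<Rightarrow> Suc p)"
        using entry_ago_code[OF i q(1)] by simp
      have p: "pos a (Suc q) = ?p m"
      proof (cases "entry_port (start X a) m")
        case None
        \<comment> \<open>Outward step \<open>m\<close> was a self-loop, so staying undoes
          it.\<close>
        then have "act a q = Stay"
          using active False B\<rho> entry by (auto simp: act tour_action_def B_def[symmetric] i_def[symmetric])
        moreover have "?p (Suc m) = ?p m"
          using None by (auto simp: entry_port_def path_Suc move_def split: if_splits)
        ultimately show ?thesis using pq by (simp add: pos_Suc)
      next
        case (Some p)
        then have "act a q = Move p"
          using active False B\<rho> entry by (auto simp: act tour_action_def B_def[symmetric] i_def[symmetric])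
        moreover have "move (net X) (?p (Suc m)) p = ?p m"
          using Some move_back[of "?p m" "exploration N m"] path_in_nodes[OF start_in_nodes[OF a]]
          by (auto simp: entry_port_def path_Suc split: if_splits)
        ultimately show ?thesis using pq by (simp add: pos_Suc)
      qed
      show ?thesis
        using p tgt active s B\<rho> False by (intro place_okI[OF new]) auto
    qed
  qed
qed

lemma place_ok_assembly_step:
  assumes ok: "place_ok a q" and a: "a \<in> team X"
    and q: "woken a \<le> q" "q + B = woken a + slot s + \<rho>" "\<rho> < 4 * B" and s: "F \<le> s"
    and act: "B \<le> s - F \<Longrightarrow> \<forall>p. act a q \<noteq> Move p"
      "s - F < B \<Longrightarrow> act a q = (if \<rho> = B \<and> attached a (s - F) then Move (exploration N (s - F)) else Stay)"
  shows "place_ok a (Suc q)"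
proof -
  have pos_q: "pos a q = target a s \<rho>" by (rule placeD(1)[OF ok q])
  have sF: "Suc s - F = Suc (s - F)" using s by simp
  show ?thesis
  proof (cases "B \<le> s - F")
    case True
    then have "pos a (Suc q) = pos a q" "entry (conf (Suc q) a) = None"
      using act(1) by (auto simp: pos_Suc entry_Suc split: action.split)
    moreover have "target a s' \<rho>' = trail B" if "s \<le> s'" for s' \<rho>'
      using that s True attached_B[OF a, of "s' - F"] by (auto simp: target_def min_def)
    ultimately show ?thesis
      using pos_q s by (intro place_ok_idle[OF q(2,3)]) auto
  next
    case False
    show ?thesis
    proof (cases "\<rho> = B \<and> attached a (s - F)")
      case True
      then have "pos a q = trail (s - F)" using pos_q s False by (simp add: target_def min_def)
      then have "pos a (Suc q) = trail (Suc (s - F))"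
        using act(2) True False by (simp add: pos_Suc path_Suc)
      moreover have "min B (Suc (s - F)) = Suc (s - F)" using False by simp
      ultimately show ?thesis
        using True False s q B_pos by (intro place_okI[of _ _ s "Suc \<rho>"]) (auto simp: target_def)
    next
      case idle: False
      then have "act a q = Stay" using act(2) False by auto
      then have "pos a (Suc q) = target a s \<rho>" "entry (conf (Suc q) a) = None"
        using pos_q by (simp_all add: pos_Suc entry_Suc)
      moreover have "target a s (Suc \<rho>) = target a s \<rho>"
        using idle s by (auto simp: target_def)
      \<comment> \<open>At the slot boundary an agent may become attached. It is then at home, which
        is exactly where the trail has arrived, so its predicted position does not jump.\<close>
      moreover have "target a (Suc s) 0 = target a s \<rho>" if "Suc \<rho> = 4 * B"
      proof -
        have "B < \<rho>" using that B_pos by linarith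
        moreover have "min B (Suc (s - F)) = Suc (s - F)" using False by simp
        ultimately show ?thesis
          using s attached_Suc[of a "s - F"] by (auto simp: target_def sF)
      qed
      ultimately show ?thesis using s by (intro place_ok_idle[OF q(2,3)]) auto
    qed
  qed
qed

text \<open>The induction covers all agents together: an action depends on completed slots, hence on
  the positions of everybody in earlier rounds.\<close>

lemma run_ok: "a \<in> team X \<Longrightarrow> status_ok a r \<and> place_ok a r"
proof (induction r arbitrary: a rule: less_induct)
  case (less r)
  note a = less.prems
  consider "r < woken a" | "r = woken a" | q where "r = Suc q" "woken a \<le> q"
    by (metis less_Suc_eq_le linorder_neqE_nat not0_implies_Suc not_less0)
  then show ?case
  proof cases
    case 1
    then show ?thesis by (auto simp: status_ok_def place_ok_def)
  next
    case 2
    have "4 * B \<le> slot (F + B)" using slot_less[of 0 "F + B"] F_pos by simp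
    then have "status_ok a r"
      using 2 seen_woken(1)[OF woken_bounds(1)[OF a]] by (simp add: status_ok_def)
    moreover have "place_ok a r"
      \<comment> \<open>At wake-up the clock stands at offset \<open>B\<close> of slot 0, where the
        tour is about to begin.\<close>
      by (rule place_okI[of _ _ 0 B])
         (use 2 before_woken[OF a, of r] target_early[of 0 B a] B_pos in auto)
    ultimately show ?thesis ..
  next
    case (3 q)
    then have qr: "q < r" by simp
    define s where "s = (q + B - woken a) div (4 * B)"
    define \<rho> where "\<rho> = (q + B - woken a) mod (4 * B)"
    have q: "woken a \<le> q" "q + B = woken a + slot s + \<rho>" "\<rho> < 4 * B"
      using 3 B_pos by (auto simp: s_def \<rho>_def slot_def)
    have ok: "place_ok b r'" if "r' \<le> q" "b \<in> team X" for r' b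
      using less.IH that qr by simp
    have status: "status_ok a q" using less.IH[OF qr a] ..
    have late: "F + B \<le> s \<longleftrightarrow> woken a + slot (F + B) \<le> q + B"
    proof
      assume "F + B \<le> s"
      then show "woken a + slot (F + B) \<le> q + B" using slot_mono[of "F + B" s] q by simp
    next
      assume "woken a + slot (F + B) \<le> q + B"
      then show "F + B \<le> s" using slot_less[of s "F + B"] q by (cases "s < F + B") auto
    qed
    have act: "act a q = (if s < F then if active a s then tour_action N (code a q) \<rho> else Stay
        else if B \<le> s - F then Declare winner
        else if \<rho> = B \<and> attached a (s - F) then Move (exploration N (s - F)) else Stay)"
      if "q + B \<le> woken a + slot (F + B)"
      by (rule act_cases[OF _ a q])
         (use ok that status q in \<open>auto simp: status_ok_def\<close>)
    have terminated: "seen a q = Terminated" if "woken a + slot (F + B) < q + B"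
      using status that q by (simp add: status_ok_def)
    have "status_ok a r"
    proof (cases "r + B \<le> woken a + slot (F + B)")
      case True
      then have early: "q + B \<le> woken a + slot (F + B)" "\<not> F + B \<le> s" using 3 late by auto
      then have "act a q \<noteq> Declare L" for L
        unfolding act[OF early(1)] by (auto simp: tour_action_def)
      moreover have "seen a q = Active (history a q)"
        using status early q by (simp add: status_ok_def)
      ultimately show ?thesis using seen_Suc[of a q] q(1) 3 True by (simp add: status_ok_def)
    next
      case False
      have "status (conf r a) = Terminated"
      proof (cases "q + B \<le> woken a + slot (F + B)")
        case True
        then have "F + B \<le> s" using False 3 late by simp
        then have "\<not> s < F" "B \<le> s - F" by auto
        then show ?thesis using act[OF True] 3 by (simp add: status_Suc)
      next
        case False
        then show ?thesis using terminated 3 by (simp add: status_Suc)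
      qed
      then show ?thesis using False by (simp add: status_ok_def seen_eq)
    qed
    moreover have "place_ok a r"
    proof (cases "s < F")
      case True
      then have "q + B \<le> woken a + slot (F + B)" using late by simp
      from act[OF this] True show ?thesis
        unfolding 3(1) by (intro place_ok_election_step[OF _ a q True] ok a) auto
    next
      case False
      show ?thesis
        unfolding 3(1)
      proof (rule place_ok_assembly_step[OF ok a q])
        show "F \<le> s" using False by simp
        show "\<forall>p. act a q \<noteq> Move p" if "B \<le> s - F"
        proof (cases "q + B \<le> woken a + slot (F + B)")
          case True
          show ?thesis using act[OF True] that False by simp
        next
          case False
          then show ?thesis using terminated by simp
        qed
        show "act a q = (if \<rho> = B \<and> attached a (s - F) then Move (exploration N (s - F)) else Stay)"
          if "s - F < B"
        proof -
          have "\<not> F + B \<le> s" using that False by simp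
          then have "q + B \<le> woken a + slot (F + B)" using late by simp
          from act[OF this] show ?thesis using False that by simp
        qed
      qed (use a in auto)
    qed
    ultimately show ?thesis ..
  qed
qed

section \<open>Declarations, gathering and the time bound\<close>

definition declaration_round :: "nat \<Rightarrow> nat" where
  "declaration_round a = woken a + slot (F + B) - B"

lemma declaration_round: "declaration_round a + B = woken a + slot (F + B)" "woken a \<le> declaration_round a"
  using slot_less[of 0 "F + B"] F_pos by (auto simp: declaration_round_def)

lemma declares_winner:
  assumes "a \<in> team X"
  shows "declares gather N X (declaration_round a) a winner"
proof -
  have "act a (declaration_round a) = Declare winner"
    using act_cases[OF _ assms declaration_round(2), of "F + B" 0] declaration_round[of a] run_ok assms B_pos
    by (simp add: status_ok_def)
  then show ?thesis by (simp add: declares_def seen_def conf_def)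
qed

lemma declaration_round_less:
  assumes "a \<in> team X"
  shows "declaration_round a < first_wake X + Suc (slot (F + B))"
  using declaration_round(1)[of a] woken_bounds(3)[OF assms] by linarith

text \<open>When \<open>a\<close> declares, any other clock lags by at most \<open>B\<close> and so
  is at least at offset \<open>3 * B\<close> of slot \<open>F + B - 1\<close>. The last step, at
  offset \<open>B\<close> of that slot, is over by then, so the declaration is already true.\<close>

lemma gathered:
  assumes a: "a \<in> team X" and b: "b \<in> team X" and r: "declaration_round a \<le> r"
  shows "pos b r = trail B"
proof -
  have near: "woken b \<le> woken a + B" using woken_diff a b by blast
  have big: "4 * B \<le> slot (F + B)" using slot_less[of 0 "F + B"] F_pos by simp
  have wr: "woken b \<le> r" using near big declaration_round(1)[of a] r by linarith
  define s where "s = (r + B - woken b) div (4 * B)"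
  define \<rho> where "\<rho> = (r + B - woken b) mod (4 * B)"
  have s: "r + B = woken b + slot s + \<rho>" "\<rho> < 4 * B"
    using wr B_pos by (auto simp: s_def \<rho>_def slot_def)
  have p: "pos b r = target b s \<rho>"
    using run_ok[OF b, of r] placeD(1)[OF _ wr s] by blast
  obtain B' where B': "B = Suc B'" using B_pos by (cases B) auto
  have late: "slot (F + B') + 3 * B \<le> slot s + \<rho>"
    using s near declaration_round(1)[of a] r B' by simp
  then have "F + B' \<le> s" using slot_less[of s "F + B'"] s(2) by (cases "s < F + B'") auto
  then consider "s = F + B'" | "F + B \<le> s" using B' by fastforce
  then show ?thesis
  proof cases
    case 1
    then have "B < \<rho>" using late B_pos by simp
    then show ?thesis
      using p 1 B' attached_B[OF b, of B] attached_Suc[of b B'] by (auto simp: target_def)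
  next
    case 2
    then show ?thesis using p attached_B[OF b, of "s - F"] by (auto simp: target_def min_def)
  qed
qed

lemma gathers: "gathers_within gather N X (Suc (slot (F + B)))"
  unfolding gathers_within_def
proof (intro bexI[of _ "trail B"] ballI)
  show "trail B \<in> nodes (net X)" by (rule path_in_nodes[OF start_in_nodes[OF winner_in_team]])
  fix a assume "a \<in> team X"
  then show "\<exists>r<first_wake X + Suc (slot (F + B)). (\<exists>L. declares gather N X r a L) \<and>
      (\<forall>r'\<ge>r. \<forall>b\<in>team X. loc (run gather N X r' b) = trail B)"
    using declares_winner declaration_round_less gathered unfolding pos_def conf_def by blast
qed

lemma elects: "elects_leader_within gather N X (Suc (slot (F + B)))"
  unfolding elects_leader_within_def
  using winner_in_team declares_winner declaration_round_less by blast

lemma F_le: "F \<le> Suc (2 * smallest_label_length X)"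
proof -
  have "Min (team X) \<in> team X" using finite_team team_nonempty by simp
  then have "bit_length winner \<le> bit_length (Min (team X))"
    using winner_bit_length label_pos winner_code by (metis F_def less_Suc_eq_le)
  also have "\<dots> \<le> smallest_label_length X"
    unfolding smallest_label_length_def by (rule bit_length_le_floorlog)
  finally show ?thesis by (simp add: F_def)
qed

end

theorem theorem1:
  shows "\<exists>A :: algorithm. computable A \<and>
    (\<exists>P :: real poly poly. \<forall>N X.
       2 \<le> N \<and> valid_scenario X \<and> card (nodes (net X)) \<le> N \<longrightarrow>
       (\<exists>T :: nat. real T \<le> poly (poly P [:real N:]) (real (smallest_label_length X)) \<and>
          gathers_within A N X T \<and> elects_leader_within A N X T))"
proof (intro exI conjI allI impI)
  show "computable gather" by (rule computable_gather)
  \<comment> \<open>The outer variable stands for \<open>N\<close> and the inner one for the label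
    length; thus \<open>E\<close> represents \<open>B\<close>, and \<open>[:[:0, 2:]:]\<close>
    represents twice the label length.\<close>
  define E :: "real poly poly" where "E = ([:0, 1:] ^ 3 + 2 * [:0, 1:] + 1) * (2 * [:0, 1:] ^ 3)"
  define P :: "real poly poly" where "P = 1 + 4 * E * (1 + [:[:0, 2:]:] + E)"
  fix N X
  assume *: "2 \<le> N \<and> valid_scenario X \<and> card (nodes (net X)) \<le> N"
  interpret gathering N X using * by unfold_locales auto
  let ?l = "real (smallest_label_length X)"
  have E: "poly (poly E [:real N:]) y = real B" for y
    by (simp add: E_def B_def exploration_length_def algebra_simps)
  have "real (Suc (slot (F + B))) = 1 + 4 * real B * (real F + real B)"
    by (simp add: slot_def)
  also have "\<dots> \<le> 1 + 4 * real B * (1 + 2 * ?l + real B)"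
    using F_le by (intro add_left_mono mult_left_mono) auto
  also have "\<dots> = poly (poly P [:real N:]) ?l"
    by (simp add: P_def E)
  finally show "real (Suc (slot (F + B))) \<le> poly (poly P [:real N:]) ?l" .
  show "gathers_within gather N X (Suc (slot (F + B)))" by (rule gathers)
  show "elects_leader_within gather N X (Suc (slot (F + B)))" by (rule elects)
qed

end
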